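(* Let $d>2$ be an integer and let $\tilde\mu$ be a probability measure on $\{2,\dots,d\}$ whose support contains at least two elements. For $E\in\mathbb R$ let $\nu^E$ be the push-forward of $\tilde\mu$ under the map $$\alpha\mapsto \begin{bmatrix}\frac{E}{\sqrt{\alpha}}&-\frac1{\sqrt{\alpha}}\\ \sqrt{\alpha}&0\end{bmatrix}\in \mathrm{SL}(2,\mathbb R),$$ and let $G_{\nu^E}$ be the smallest subgroup of $\mathrm{SL}(2,\mathbb R)$ that contains $\operatorname{supp}\nu^E$. Then: (1) for every $E\in\mathbb R\setminus\{0\}$, $G_{\nu^E}$ is a non-compact, strongly irreducible, contracting subgroup; (2) for every $E\in\mathbb R$, $\{V\in\mathbb{RP}^1: MV=V \text{ for every } M\in G_{\nu^E}\}=\emptyset$; (3) the Lyapunov exponent $L(E)$ is a continuous function of the energy $E\in\mathbb R$; (4) $L(E)>0$ if $E\neq0$, and $L(0)=0$.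
   Context: Notation: $\mathbb Z^+=\{0,1,2,\dots\}$, $\Omega=(\operatorname{supp}\tilde\mu)^{\mathbb Z^+}$, $\mu=\tilde\mu^{\mathbb Z^+}$, and $(T\omega)_n=\omega_{n+1}$ is the left shift on $\Omega$. For $E\in\mathbb R$ and $\omega\in\Omega$ let $$\mathcal M^E(\omega)=\begin{bmatrix}\frac{E}{\sqrt{\omega_1}}&-\frac1{\sqrt{\omega_1}}\\ \sqrt{\omega_1}&0\end{bmatrix},\qquad \mathcal M_n^E(\omega)=\mathcal M^E(T^{n-1}\omega)\cdots\mathcal M^E(T\omega)\mathcal M^E(\omega),\quad n\ge1.$$ The Lyapunov exponent is $L(E)=\lim_{n\to\infty}\frac1n\int_\Omega\log\|\mathcal M_n^E(\omega)\|\,d\mu(\omega)$. $\mathrm{SL}(2,\mathbb R)$ acts on the projective line $\mathbb{RP}^1$ of one-dimensional subspaces of $\mathbb R^2$. A subgroup $G\subset\mathrm{SL}(2,\mathbb R)$ is strongly irreducible if there is no nonempty finite set $\mathcal F\subset\mathbb{RP}^1$ such that $M\mathcal F=\mathcal F$ for all $M\in G$. A subgroup $G$ is contracting if there exists a sequence $\{g_n\}_{n=1}^\infty\subset G$ such that $\|g_n\|^{-1}g_n$ converges to a rank-one matrix. *)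

theory Defs
  imports
    "HOL-Probability.Probability"
    "HOL-Algebra.Generated_Groups"
begin

type_synonym mat2 = "real^2^2"

(* Matrix norms are operator norms throughout; the norm which the
   type real^2^2 carries in the library is the Frobenius norm instead. *)
definition opnorm :: "mat2 \<Rightarrow> real" where
  "opnorm A = onorm (\<lambda>x. A *v x)"


definition SL2 :: "mat2 monoid" where
  "SL2 = \<lparr>carrier = {A. det A = 1}, mult = (**), one = mat 1\<rparr>"

lemma group_SL2: "group SL2"
proof (rule groupI)
  fix A assume "A \<in> carrier SL2"
  then have d: "det A = 1" by (simp add: SL2_def)
  then have "invertible A" by (simp add: invertible_det_nz)
  then obtain B where B: "A ** B = mat 1" "B ** A = mat 1"
    unfolding invertible_def by blast
  have "det B * det A = 1"
    using B(2) det_mul[of B A] by simp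
  with d B show "\<exists>B\<in>carrier SL2. B \<otimes>\<^bsub>SL2\<^esub> A = \<one>\<^bsub>SL2\<^esub>"
    by (auto simp: SL2_def)
qed (auto simp: SL2_def det_mul matrix_mul_assoc)

definition RP1 :: "(real^2) set set" where
  "RP1 = {V. subspace V \<and> dim V = 1}"

definition act :: "mat2 \<Rightarrow> (real^2) set \<Rightarrow> (real^2) set" where
  "act M V = (\<lambda>x. M *v x) ` V"

definition strongly_irreducible :: "mat2 set \<Rightarrow> bool" where
  "strongly_irreducible G \<longleftrightarrow>
     \<not> (\<exists>F. F \<subseteq> RP1 \<and> finite F \<and> F \<noteq> {} \<and> (\<forall>M\<in>G. act M ` F = F))"

definition contracting :: "mat2 set \<Rightarrow> bool" where
  "contracting G \<longleftrightarrow>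
     (\<exists>g :: nat \<Rightarrow> mat2. (\<forall>n. g n \<in> G) \<and>
        (\<exists>A. rank A = 1 \<and> (\<lambda>n. inverse (opnorm (g n)) *\<^sub>R g n) \<longlonglongrightarrow> A))"


definition one_step :: "real \<Rightarrow> nat \<Rightarrow> mat2" where
  "one_step E \<alpha> = vector [vector [E / sqrt (real \<alpha>), - 1 / sqrt (real \<alpha>)],
                          vector [sqrt (real \<alpha>), 0]]"

lemma one_step_in_SL2: "\<alpha> > 0 \<Longrightarrow> one_step E \<alpha> \<in> carrier SL2"
  by (simp add: one_step_def SL2_def det_2)

definition nu :: "nat pmf \<Rightarrow> real \<Rightarrow> mat2 pmf" where
  "nu p E = map_pmf (one_step E) p"

(* By group.generate_minimal, the generated subgroup is the intersection of all
   subgroups containing the generators, as these lie in SL2. *)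
definition G_nu :: "nat pmf \<Rightarrow> real \<Rightarrow> mat2 set" where
  "G_nu p E = generate SL2 (set_pmf (nu p E))"


definition Omega :: "nat pmf \<Rightarrow> (nat \<Rightarrow> nat) set" where
  "Omega p = (UNIV \<rightarrow> set_pmf p)"

(* Each factor is cut down to the support, so that the underlying space is Omega. *)
definition mu :: "nat pmf \<Rightarrow> (nat \<Rightarrow> nat) measure" where
  "mu p = PiM UNIV (\<lambda>_. restrict_space (measure_pmf p) (set_pmf p))"

lemma space_mu: "space (mu p) = Omega p"
  by (simp add: mu_def Omega_def space_PiM space_restrict_space PiE_def)

definition shift :: "(nat \<Rightarrow> nat) \<Rightarrow> nat \<Rightarrow> nat" where
  "shift \<omega> = (\<lambda>n. \<omega> (Suc n))"

(* Sequences are indexed from 0, but the cocycle reads the entry at index 1. *)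
definition cocycle :: "real \<Rightarrow> (nat \<Rightarrow> nat) \<Rightarrow> mat2" where
  "cocycle E \<omega> = one_step E (\<omega> 1)"

fun cocycle_iter :: "nat \<Rightarrow> real \<Rightarrow> (nat \<Rightarrow> nat) \<Rightarrow> mat2" where
  "cocycle_iter 0 E \<omega> = mat 1"
| "cocycle_iter (Suc n) E \<omega> = cocycle E ((shift ^^ n) \<omega>) ** cocycle_iter n E \<omega>"

definition lyap_avg :: "nat pmf \<Rightarrow> real \<Rightarrow> nat \<Rightarrow> real" where
  "lyap_avg p E n = 1 / real n * (\<integral>\<omega>. ln (opnorm (cocycle_iter n E \<omega>)) \<partial>mu p)"

definition lyapunov :: "nat pmf \<Rightarrow> real \<Rightarrow> real" where
  "lyapunov p E = lim (lyap_avg p E)"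

end

theory Submission
  imports Defs
begin

text \<open>
  \<open>M\<^sub>a M\<^sub>b\<^sup>-\<^sup>1\<close> is a hyperbolic diagonal matrix for any two letters \<open>a \<noteq> b\<close>, so a finite invariant
  set of lines can only contain the two coordinate axes; the second axis is mapped to the first one,
  and the first one leaves the axes if \<open>E \<noteq> 0\<close>. This gives the assertions on the group.

  Positivity of \<open>L(E)\<close>: averaging a function over the words of length three is a strict contraction of
  \<open>L\<^sup>2(\<real>\<^sup>2)\<close>, since the mass of an almost invariant function would have to concentrate near the
  axes and near their images at once. Applied to the indicator of the unit disc this makes
  \<open>\<parallel>M\<^sub>n\<parallel>\<close> exponentially large with high probability.

  Continuity: \<open>L\<close> is the infimum of the continuous functions \<open>(1/n) \<integral> log \<parallel>M\<^sub>n\<parallel>\<close>, hence upper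
  semicontinuous, and \<open>L \<ge> 0 = L(0)\<close>. If \<open>E \<noteq> 0\<close>, the image of a line under a long random product
  hits any given line with small probability only, so \<open>\<integral> log \<bar>M\<^sub>n x\<bar> \<ge> \<integral> log \<parallel>M\<^sub>n\<parallel> - K - \<epsilon> n\<close> uniformly
  in the unit vector \<open>x\<close>. The minimum over \<open>x\<close> of the left-hand side is superadditive in \<open>n\<close>, which makes
  \<open>L\<close> locally a supremum of continuous functions as well.
\<close>

subsection \<open>Matrices in the plane\<close>

text \<open>The support is finite, so expectations are finite weighted sums \<open>avg\<close> over
  words; the product measure enters only through \<open>integral_prefix\<close>. Matrices of
  determinant one preserve Lebesgue measure, so composition with them is an isometry of
  square-integrable functions, and no stationary measure on lines has to be constructed. Length
  three comes from \<open>sector_cover\<close>: the hyperbolic quotient controls a function only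
  away from the axes, and up to two further steps may be needed to move a vector off them. The value
  at energy zero is a diffusive effect: products of two letters are diagonal, and the logarithm of
  the norm along even lengths is the absolute value of a centred random walk, of order sqrt n. The
  obstacle to lower semicontinuity is that norms are only submultiplicative, so that a lower bound
  at one length says nothing about longer words. Starting from the worst unit vector restores
  superadditivity; one estimate at a fixed length, stable under small changes of the energy, then
  bounds the exponent nearby.\<close>

definition wedge :: "real^2 \<Rightarrow> real^2 \<Rightarrow> real" where
  "wedge x y = x$1 * y$2 - x$2 * y$1"

lemma vec2_eq_iff: "(x :: 'a^2) = y \<longleftrightarrow> x$1 = y$1 \<and> x$2 = y$2"
  by (simp add: vec_eq_iff forall_2)

lemma matrix_vector_2:
  fixes A :: mat2
  shows "(A *v x)$1 = A$1$1 * x$1 + A$1$2 * x$2" "(A *v x)$2 = A$2$1 * x$1 + A$2$2 * x$2"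
  by (simp_all add: matrix_vector_mult_def sum_2)

lemma matrix_matrix_2:
  fixes A B :: mat2
  shows "(A ** B)$i$j = A$i$1 * B$1$j + A$i$2 * B$2$j"
  by (simp add: matrix_matrix_mult_def sum_2)

lemma wedge_matrix: "wedge (A *v x) (A *v y) = det A * wedge x y"
  by (simp add: wedge_def matrix_vector_2 det_2 algebra_simps)

lemma norm_sq_2: "norm (x :: real^2) ^ 2 = (x$1)^2 + (x$2)^2"
  by (simp add: norm_vec_def L2_set_def sum_2)

text \<open>Lagrange's identity: the square of the product of the norms exceeds the square of
  \<open>wedge x y\<close> by the square of the inner product.\<close>

lemma wedge_le: "\<bar>wedge x y\<bar> \<le> norm x * norm y"
proof -
  have "(wedge x y)^2 \<le> (norm x * norm y)^2"
    unfolding power_mult_distrib norm_sq_2 wedge_def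
    using zero_le_power2[of "x$1*y$1 + x$2*y$2"]
    by (simp add: power2_eq_square algebra_simps)
  then show ?thesis using abs_le_square_iff[of "wedge x y" "norm x * norm y"] by (simp add: abs_mult)
qed

lemma wedge_eq_0_imp:
  assumes "wedge x y = 0" "x \<noteq> 0"
  shows "\<exists>c. y = c *\<^sub>R x"
proof (cases "x$1 = 0")
  case True
  then have "x$2 \<noteq> 0" using assms(2) by (auto simp: vec2_eq_iff)
  then show ?thesis using assms(1) True
    by (intro exI[of _ "y$2/x$2"]) (auto simp: vec2_eq_iff wedge_def field_simps)
next
  case False
  then show ?thesis using assms(1)
    by (intro exI[of _ "y$1/x$1"]) (auto simp: vec2_eq_iff wedge_def field_simps)
qed

lemma norm_le_opnorm: "norm (A *v x) \<le> opnorm A * norm x"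
  unfolding opnorm_def by (rule onorm[OF matrix_vector_mul_bounded_linear])

lemma opnorm_le: "(\<And>x. norm (A *v x) \<le> b * norm x) \<Longrightarrow> opnorm A \<le> b"
  unfolding opnorm_def by (rule onorm_le)

lemma opnorm_nonneg: "0 \<le> opnorm A"
  unfolding opnorm_def by (rule onorm_pos_le[OF matrix_vector_mul_bounded_linear])

lemma opnorm_mult: "opnorm (A ** B) \<le> opnorm A * opnorm B"
proof (rule opnorm_le)
  fix x
  have "norm ((A ** B) *v x) = norm (A *v (B *v x))"
    by (simp add: matrix_vector_mul_assoc)
  also have "\<dots> \<le> opnorm A * (opnorm B * norm x)"
    by (rule order_trans[OF norm_le_opnorm])
      (intro mult_left_mono norm_le_opnorm opnorm_nonneg)
  finally show "norm ((A ** B) *v x) \<le> opnorm A * opnorm B * norm x"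
    by (simp add: mult.assoc)
qed

text \<open>In SL(2) a matrix and its inverse have the same operator norm. Preservation of area
  gives this bound without forming the inverse.\<close>

lemma norm_le_opnorm_mult:
  assumes "det A = 1"
  shows "norm x \<le> opnorm A * norm (A *v x)"
proof (cases "x = 0")
  case False
  \<comment> \<open>\<open>x\<close> turned by a right angle, so that \<open>wedge x y\<close> is
    the squared norm of \<open>x\<close>.\<close>
  define y :: "real^2" where "y = vector [- x$2, x$1]"
  have y: "norm y = norm x"
    by (rule power2_eq_imp_eq) (simp_all only: norm_sq_2 norm_ge_zero, simp add: y_def)
  have "norm x * norm x = wedge x y"
    using norm_sq_2[of x] by (simp add: y_def wedge_def power2_eq_square)
  also have "\<dots> = wedge (A *v x) (A *v y)" by (simp add: wedge_matrix assms)
  also have "\<dots> \<le> norm (A *v x) * norm (A *v y)" using wedge_le[of "A *v x" "A *v y"] by linarith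
  also have "\<dots> \<le> norm (A *v x) * (opnorm A * norm x)"
    unfolding y[symmetric] by (intro mult_left_mono norm_le_opnorm) auto
  finally have "norm x * norm x \<le> (opnorm A * norm (A *v x)) * norm x" by (simp add: ac_simps)
  then show ?thesis using False by simp
qed (simp add: opnorm_nonneg)

lemma opnorm_ge_1:
  assumes "det A = 1"
  shows "1 \<le> opnorm A"
proof -
  define x :: "real^2" where "x = axis 1 1"
  have x: "norm x = 1" by (simp add: x_def norm_axis_1)
  have "norm x \<le> opnorm A * (opnorm A * norm x)"
    by (rule order_trans[OF norm_le_opnorm_mult[OF assms]])
      (intro mult_left_mono norm_le_opnorm opnorm_nonneg)
  then have "1 \<le> opnorm A ^ 2" by (simp add: x power2_eq_square)
  then show ?thesis using opnorm_nonneg by (intro power2_le_imp_le[of 1 "opnorm A"]) simp_all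
qed

text \<open>Cramer's rule \<open>wedge a b *\<^sub>R e = wedge e b *\<^sub>R a - wedge e a *\<^sub>R b\<close>: two directions
  that are both contracted by a matrix of large norm are close to each other.\<close>

lemma wedge_opnorm_le:
  assumes "norm a \<le> c" "norm b \<le> c"
  shows "\<bar>wedge a b\<bar> * opnorm M \<le> c * (norm (M *v a) + norm (M *v b))"
proof -
  have c: "0 \<le> c" using assms(1) norm_ge_zero order_trans by blast
  have "opnorm (wedge a b *\<^sub>R M) \<le> c * (norm (M *v a) + norm (M *v b))"
  proof (rule opnorm_le)
    fix e :: "real^2"
    have "wedge a b *\<^sub>R e = wedge e b *\<^sub>R a - wedge e a *\<^sub>R b"
      by (simp add: vec2_eq_iff wedge_def algebra_simps)
    then have "M *v (wedge a b *\<^sub>R e) = M *v (wedge e b *\<^sub>R a - wedge e a *\<^sub>R b)" by simp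
    then have "(wedge a b *\<^sub>R M) *v e = wedge e b *\<^sub>R (M *v a) - wedge e a *\<^sub>R (M *v b)"
      by (simp add: matrix_vector_mult_diff_distrib matrix_vector_mult_scaleR
          scaleR_matrix_vector_assoc)
    then have "norm ((wedge a b *\<^sub>R M) *v e) \<le> \<bar>wedge e b\<bar> * norm (M *v a) + \<bar>wedge e a\<bar> * norm (M *v b)"
      by (metis norm_scaleR norm_triangle_ineq4)
    also have "\<dots> \<le> (c * norm e) * norm (M *v a) + (c * norm e) * norm (M *v b)"
    proof (intro add_mono mult_right_mono norm_ge_zero)
      show "\<bar>wedge e b\<bar> \<le> c * norm e"
        by (rule order_trans[OF wedge_le]) (metis assms(2) mult.commute mult_right_mono norm_ge_zero)
      show "\<bar>wedge e a\<bar> \<le> c * norm e"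
        by (rule order_trans[OF wedge_le]) (metis assms(1) mult.commute mult_right_mono norm_ge_zero)
    qed
    finally show "norm ((wedge a b *\<^sub>R M) *v e) \<le> c * (norm (M *v a) + norm (M *v b)) * norm e"
      by (simp add: algebra_simps)
  qed
  moreover have "opnorm (wedge a b *\<^sub>R M) = \<bar>wedge a b\<bar> * opnorm M"
    unfolding opnorm_def
    using onorm_scaleR[OF matrix_vector_mul_bounded_linear, of "wedge a b" M]
    by (simp add: scaleR_matrix_vector_assoc)
  ultimately show ?thesis by simp
qed

lemma opnorm_le_sum_abs:
  fixes A :: mat2
  shows "opnorm A \<le> \<bar>A$1$1\<bar> + \<bar>A$1$2\<bar> + \<bar>A$2$1\<bar> + \<bar>A$2$2\<bar>"
proof (rule opnorm_le)
  fix x :: "real^2"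
  have "norm (A *v x) \<le> \<bar>(A *v x)$1\<bar> + \<bar>(A *v x)$2\<bar>"
    using norm_le_l1_cart[of "A *v x"] by (simp add: sum_2)
  also have "\<dots> \<le> (\<bar>A$1$1\<bar> * \<bar>x$1\<bar> + \<bar>A$1$2\<bar> * \<bar>x$2\<bar>) + (\<bar>A$2$1\<bar> * \<bar>x$1\<bar> + \<bar>A$2$2\<bar> * \<bar>x$2\<bar>)"
    unfolding matrix_vector_2 abs_mult[symmetric] by (intro add_mono abs_triangle_ineq)
  also have "\<dots> \<le> (\<bar>A$1$1\<bar> * norm x + \<bar>A$1$2\<bar> * norm x) + (\<bar>A$2$1\<bar> * norm x + \<bar>A$2$2\<bar> * norm x)"
    by (intro add_mono mult_left_mono component_le_norm_cart) auto
  finally show "norm (A *v x) \<le> (\<bar>A$1$1\<bar> + \<bar>A$1$2\<bar> + \<bar>A$2$1\<bar> + \<bar>A$2$2\<bar>) * norm x"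
    by (simp add: algebra_simps)
qed

lemma opnorm_diff_le: "\<bar>opnorm A - opnorm B\<bar> \<le> opnorm (A - B)"
proof -
  have le: "opnorm A \<le> opnorm (A - B) + opnorm B" for A B
    unfolding opnorm_def
    using onorm_triangle[OF matrix_vector_mul_bounded_linear matrix_vector_mul_bounded_linear, of "A - B" B]
    by (simp add: matrix_vector_mult_diff_rdistrib)
  have "opnorm (B - A) = opnorm (A - B)"
    unfolding opnorm_def
    using onorm_neg[of "\<lambda>x. (A - B) *v x"]
    by (simp add: matrix_vector_mult_diff_rdistrib[abs_def])
  then show ?thesis using le[of A B] le[of B A] by linarith
qed

definition diag2 :: "real \<Rightarrow> real \<Rightarrow> mat2" where
  "diag2 a b = vector [vector [a, 0], vector [0, b]]"

lemma diag2_nth [simp]: "diag2 a b $ 1 $ 1 = a" "diag2 a b $ 1 $ 2 = 0"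
  "diag2 a b $ 2 $ 1 = 0" "diag2 a b $ 2 $ 2 = b"
  by (simp_all add: diag2_def)

lemma opnorm_diag2:
  "opnorm (diag2 a b) = max \<bar>a\<bar> \<bar>b\<bar>"
proof (rule antisym)
  show "opnorm (diag2 a b) \<le> max \<bar>a\<bar> \<bar>b\<bar>"
  proof (rule opnorm_le)
    fix x :: "real^2"
    have "norm (diag2 a b *v x) ^ 2 \<le> (max \<bar>a\<bar> \<bar>b\<bar> * norm x) ^ 2"
      unfolding power_mult_distrib norm_sq_2 matrix_vector_2 diag2_nth distrib_left
      by (simp add: power_mult_distrib del: abs_power2, intro add_mono mult_right_mono)
        (auto simp: abs_le_square_iff[symmetric])
    then show "norm (diag2 a b *v x) \<le> max \<bar>a\<bar> \<bar>b\<bar> * norm x"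
      by (rule power2_le_imp_le) simp
  qed
  have "norm (diag2 a b *v axis 1 1) = \<bar>a\<bar>" "norm (diag2 a b *v axis 2 1) = \<bar>b\<bar>"
    by (auto intro!: power2_eq_imp_eq[of "norm _"] simp: norm_sq_2 matrix_vector_2 axis_def)
  then show "max \<bar>a\<bar> \<bar>b\<bar> \<le> opnorm (diag2 a b)"
    using norm_le_opnorm[of "diag2 a b" "axis 1 1"] norm_le_opnorm[of "diag2 a b" "axis 2 1"]
    by (simp add: norm_axis_1)
qed

lemma diag2_apply: "(diag2 a b *v x)$1 = a * x$1" "(diag2 a b *v x)$2 = b * x$2"
  by (simp_all add: matrix_vector_2)

lemma diag2_mult: "diag2 a b ** diag2 a' b' = diag2 (a * a') (b * b')"
  by (simp add: vec2_eq_iff matrix_matrix_2)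

lemma one_step_nth [simp]: "one_step E a $ 1 $ 1 = E / sqrt a" "one_step E a $ 1 $ 2 = - 1 / sqrt a"
  "one_step E a $ 2 $ 1 = sqrt a" "one_step E a $ 2 $ 2 = 0"
  by (simp_all add: one_step_def)

lemma det_one_step: "a > 0 \<Longrightarrow> det (one_step E a) = 1"
  by (simp add: det_2)

text \<open>The quotient of two letters, written without an inverse. The diagonal factor is the same
  for all energies.\<close>

lemma diag2_mult_one_step:
  "a > 0 \<Longrightarrow> b > 0 \<Longrightarrow> diag2 (sqrt (b / a)) (sqrt (a / b)) ** one_step E b = one_step E a"
  by (simp add: vec2_eq_iff matrix_matrix_2 real_sqrt_divide)

text \<open>The first letter of a word acts first.\<close>

primrec word_mat :: "real \<Rightarrow> nat list \<Rightarrow> mat2" where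
  "word_mat E [] = mat 1"
| "word_mat E (a # w) = word_mat E w ** one_step E a"

lemma word_mat_append: "word_mat E (v @ w) = word_mat E w ** word_mat E v"
  by (induction v) (simp_all add: matrix_mul_assoc)

lemma word_mat_append_apply: "word_mat E (v @ w) *v x = word_mat E w *v (word_mat E v *v x)"
  by (simp add: word_mat_append matrix_vector_mul_assoc)

lemma det_word_mat: "(\<And>a. a \<in> set w \<Longrightarrow> a > 0) \<Longrightarrow> det (word_mat E w) = 1"
  by (induction w) (simp_all add: det_mul det_one_step)

subsection \<open>Averages over words and subadditivity\<close>

lemma subadditive_bound:
  fixes a :: "nat \<Rightarrow> real"
  assumes sub: "\<And>m n. a (m + n) \<le> a m + a n" and "m > 0"
  shows "a n \<le> real (n div m) * a m + a (n mod m)"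
proof (induction n rule: less_induct)
  case (less n)
  show ?case
  proof (cases "n < m")
    case False
    then have "a n \<le> a m + a (n - m)" using sub[of m "n - m"] by simp
    also have "\<dots> \<le> a m + (real ((n - m) div m) * a m + a ((n - m) mod m))"
      using less[of "n - m"] False \<open>m > 0\<close> by simp
    finally show ?thesis using False \<open>m > 0\<close>
      by (simp add: le_div_geq le_mod_geq algebra_simps)
  qed simp
qed

text \<open>Nonnegativity bounds the quotients from below and also allows \<open>n div m\<close> to
  be replaced by the larger real quotient n / m.\<close>

lemma Fekete:
  fixes a :: "nat \<Rightarrow> real"
  assumes sub: "\<And>m n. a (m + n) \<le> a m + a n" and nonneg: "\<And>n. 0 \<le> a n"
  shows "(\<lambda>n. a n / n) \<longlonglongrightarrow> (INF n\<in>{1..}. a n / n)"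
proof -
  define L where "L = (INF n\<in>{1..}. a n / real n)"
  have bdd: "bdd_below ((\<lambda>n. a n / real n) ` {1..})"
    by (rule bdd_belowI[of _ 0]) (auto simp: nonneg)
  have L_le: "L \<le> a n / n" if "n \<ge> 1" for n
    unfolding L_def by (rule cINF_lower[OF bdd]) (use that in auto)
  have "(\<lambda>n. a n / n) \<longlonglongrightarrow> L"
  proof (rule order_tendstoI)
    fix y assume "y < L"
    then show "\<forall>\<^sub>F n in sequentially. y < a n / n"
      by (intro eventually_sequentiallyI[of 1] less_le_trans[OF _ L_le])
  next
    fix y assume "L < y"
    then obtain m where m: "m \<ge> 1" "a m / m < y"
      unfolding L_def by (subst (asm) cINF_less_iff[OF _ bdd]) auto
    \<comment> \<open>A bound for the contribution of all remainders \<open>n mod m\<close>; divided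
      by \<open>n\<close> it vanishes in the limit.\<close>
    define K where "K = Max (a ` {..<m})"
    have K: "a k \<le> K" if "k < m" for k
      unfolding K_def by (rule Max_ge) (use that in auto)
    have "\<forall>\<^sub>F n in sequentially. K / real n < y - a m / m"
      by (rule order_tendstoD(2)[OF tendsto_divide_0[OF tendsto_const]])
        (use m in \<open>auto simp: filterlim_at_top_imp_at_infinity filterlim_real_sequentially\<close>)
    then show "\<forall>\<^sub>F n in sequentially. a n / n < y"
      using eventually_gt_at_top[of 0]
    proof eventually_elim
      case (elim n)
      have "a n \<le> real (n div m) * a m + a (n mod m)"
        using subadditive_bound[of a m n] sub m(1) by simp
      also have "\<dots> \<le> (real n / real m) * a m + K"
        using m(1) nonneg by (intro add_mono mult_right_mono K) (auto simp: of_nat_div_le_of_nat)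
      finally have "a n / n \<le> a m / m + K / n"
        using elim(2) m(1) by (simp add: field_simps)
      with elim(1) show ?case by linarith
    qed
  qed
  then show ?thesis by (simp add: L_def)
qed

locale letters =
  fixes p :: "nat pmf" and d :: nat
  assumes supp: "set_pmf p \<subseteq> {2..d}" and card_supp: "card (set_pmf p) \<ge> 2"
begin

definition words :: "nat \<Rightarrow> nat list set" where
  "words n = {w. set w \<subseteq> set_pmf p \<and> length w = n}"

definition wt :: "nat list \<Rightarrow> real" where
  "wt w = prod_list (map (pmf p) w)"

text \<open>The expectation of \<open>F\<close> at a word of \<open>n\<close> independent letters
  with law \<open>p\<close>.\<close>

definition avg :: "nat \<Rightarrow> (nat list \<Rightarrow> real) \<Rightarrow> real" where
  "avg n F = (\<Sum>w\<in>words n. wt w * F w)"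

lemma finite_supp [simp]: "finite (set_pmf p)"
  using supp finite_subset by blast

lemma letter_pos: "a \<in> set_pmf p \<Longrightarrow> a > 0"
  using supp by auto

lemma finite_words [simp]: "finite (words n)"
  unfolding words_def by (rule finite_lists_length_eq) simp

lemma words_0 [simp]: "words 0 = {[]}"
  by (auto simp: words_def)

lemma words_Suc: "words (Suc n) = (\<lambda>(a, w). a # w) ` (set_pmf p \<times> words n)"
  by (auto simp: words_def length_Suc_conv)

lemma Cons_in_words [simp]: "a # w \<in> words (Suc n) \<longleftrightarrow> a \<in> set_pmf p \<and> w \<in> words n"
  by (auto simp: words_def)

lemma append_in_words: "v \<in> words m \<Longrightarrow> w \<in> words n \<Longrightarrow> v @ w \<in> words (m + n)"
  by (auto simp: words_def)

lemma wt_pos: "w \<in> words n \<Longrightarrow> wt w > 0"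
  by (induction w arbitrary: n) (auto simp: wt_def words_def pmf_positive)

lemma wt_nonneg: "w \<in> words n \<Longrightarrow> 0 \<le> wt w"
  using wt_pos by (rule less_imp_le)

lemma avg_0 [simp]: "avg 0 F = F []"
  by (simp add: avg_def wt_def)

lemma avg_Suc: "avg (Suc n) F = (\<Sum>a\<in>set_pmf p. pmf p a * avg n (\<lambda>w. F (a # w)))"
proof -
  have "avg (Suc n) F = (\<Sum>(a, w)\<in>set_pmf p \<times> words n. wt (a # w) * F (a # w))"
    unfolding avg_def words_Suc by (subst sum.reindex) (auto simp: inj_on_def case_prod_unfold)
  then show ?thesis
    by (simp add: avg_def sum.cartesian_product wt_def sum_distrib_left mult.assoc)
qed

text \<open>Independence of consecutive blocks of letters: the outer average runs over the block
  that acts first.\<close>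

lemma avg_append: "avg (m + n) F = avg m (\<lambda>v. avg n (\<lambda>w. F (v @ w)))"
  by (induction m arbitrary: F) (simp_all add: avg_Suc)

lemma avg_add: "avg n (\<lambda>w. F w + G w) = avg n F + avg n G"
  by (simp add: avg_def distrib_left sum.distrib)

lemma avg_cmult: "avg n (\<lambda>w. c * F w) = c * avg n F"
  by (simp add: avg_def sum_distrib_left ac_simps)

lemma avg_diff: "avg n (\<lambda>w. F w - G w) = avg n F - avg n G"
  by (simp add: avg_def right_diff_distrib sum_subtractf)

lemma avg_const [simp]: "avg n (\<lambda>_. c) = c"
proof (induction n)
  case (Suc n)
  have "(\<Sum>a\<in>set_pmf p. pmf p a) = 1" by (rule sum_pmf_eq_1) auto
  with Suc show ?case by (simp add: avg_Suc sum_distrib_right[symmetric])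
qed simp

lemma avg_sum: "avg n (\<lambda>w. \<Sum>i\<in>I. F i w) = (\<Sum>i\<in>I. avg n (F i))"
  unfolding avg_def sum_distrib_left by (rule sum.swap)

lemma avg_swap: "avg m (\<lambda>v. avg n (\<lambda>w. F v w)) = avg n (\<lambda>w. avg m (\<lambda>v. F v w))"
  unfolding avg_def sum_distrib_left
  by (subst sum.swap) (simp add: ac_simps)

lemma avg_mono: "(\<And>w. w \<in> words n \<Longrightarrow> F w \<le> G w) \<Longrightarrow> avg n F \<le> avg n G"
  unfolding avg_def by (intro sum_mono mult_left_mono) (auto intro: wt_nonneg)

lemma avg_cong: "(\<And>w. w \<in> words n \<Longrightarrow> F w = G w) \<Longrightarrow> avg n F = avg n G"
  unfolding avg_def by (intro sum.cong) auto

lemma avg_nonneg: "(\<And>w. w \<in> words n \<Longrightarrow> 0 \<le> F w) \<Longrightarrow> 0 \<le> avg n F"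
  using avg_mono[of n "\<lambda>_. 0" F] by simp

lemma avg_le_const: "(\<And>w. w \<in> words n \<Longrightarrow> F w \<le> c) \<Longrightarrow> avg n F \<le> c"
  using avg_mono[of n F "\<lambda>_. c"] by simp

lemma avg_ge_const: "(\<And>w. w \<in> words n \<Longrightarrow> c \<le> F w) \<Longrightarrow> c \<le> avg n F"
  using avg_mono[of n "\<lambda>_. c" F] by simp

lemma sum_wt: "(\<Sum>w\<in>words n. wt w) = 1"
  using avg_const[of n 1, unfolded avg_def] by simp

text \<open>There are finitely many words of one length, each of positive weight. The constant turns
  one favourable word into a quantitative gain, in \<open>spectral_gap\<close> and in
  \<open>hit_small\<close>.\<close>

lemma wt_lower_bound: obtains \<kappa> where "\<kappa> > 0" "\<kappa> \<le> 1" "\<And>w. w \<in> words n \<Longrightarrow> \<kappa> \<le> wt w"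
proof -
  have ne: "words n \<noteq> {}" using sum_wt[of n] by auto
  define \<kappa> where "\<kappa> = Min (wt ` words n)"
  have "\<kappa> \<in> wt ` words n" unfolding \<kappa>_def using ne by (intro Min_in) auto
  then obtain w where w: "w \<in> words n" "\<kappa> = wt w" by auto
  have "wt w \<le> (\<Sum>w\<in>words n. wt w)"
    using w by (intro member_le_sum) (auto intro: wt_nonneg)
  then show thesis using that[of \<kappa>] w wt_pos sum_wt by (auto simp: \<kappa>_def)
qed

lemma two_letters: obtains a b where "a \<in> set_pmf p" "b \<in> set_pmf p" "a < b"
proof -
  obtain a b where "a \<in> set_pmf p" "b \<in> set_pmf p" "a \<noteq> b"
    using card_supp card_le_Suc0_iff_eq[OF finite_supp] by force
  then show thesis using that[of a b] that[of b a] by linarith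
qed

lemma det_word [simp]: "w \<in> words n \<Longrightarrow> det (word_mat E w) = 1"
  by (rule det_word_mat) (auto simp: words_def letter_pos)

text \<open>The strict bound \<open>C > 1\<close> is kept because \<open>mean_log_at_ge\<close>
  divides by \<open>ln C\<close>.\<close>

lemma one_step_bound: obtains C where "C > 1" "\<And>a. a \<in> set_pmf p \<Longrightarrow> opnorm (one_step E a) \<le> C"
proof -
  let ?M = "Max ((\<lambda>a. opnorm (one_step E a)) ` set_pmf p)"
  have "opnorm (one_step E a) \<le> ?M" if "a \<in> set_pmf p" for a
    by (rule Max_ge) (use that in auto)
  then show thesis using that[of "max 2 ?M"] by (simp add: le_max_iff_disj)
qed

lemma opnorm_word_le:
  assumes "\<And>a. a \<in> set_pmf p \<Longrightarrow> opnorm (one_step E a) \<le> C" "w \<in> words n"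
  shows "opnorm (word_mat E w) \<le> C ^ n"
  using assms(2)
proof (induction w arbitrary: n)
  case Nil
  then show ?case by (auto simp: words_def intro!: opnorm_le)
next
  case (Cons a w)
  then obtain k where k: "n = Suc k" "a \<in> set_pmf p" "w \<in> words k"
    by (auto simp: words_def length_Suc_conv)
  have C: "0 \<le> C" using assms(1)[OF k(2)] opnorm_nonneg order_trans by blast
  have "opnorm (word_mat E (a # w)) \<le> opnorm (word_mat E w) * opnorm (one_step E a)"
    by (simp add: opnorm_mult)
  also have "\<dots> \<le> C ^ k * C" using C
    by (intro mult_mono Cons.IH assms(1) k opnorm_nonneg) auto
  finally show ?case by (simp add: k mult.commute)
qed

definition mean_log :: "nat \<Rightarrow> real \<Rightarrow> real" where
  "mean_log n E = avg n (\<lambda>w. ln (opnorm (word_mat E w)))"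

lemma opnorm_word_ge_1: "w \<in> words n \<Longrightarrow> 1 \<le> opnorm (word_mat E w)"
  by (rule opnorm_ge_1) simp

lemma mean_log_nonneg: "0 \<le> mean_log n E"
  unfolding mean_log_def by (rule avg_nonneg) (simp add: opnorm_word_ge_1)

lemma mean_log_subadd: "mean_log (m + n) E \<le> mean_log m E + mean_log n E"
proof -
  have "mean_log (m + n) E = avg m (\<lambda>v. avg n (\<lambda>w. ln (opnorm (word_mat E (v @ w)))))"
    by (simp add: mean_log_def avg_append)
  also have "\<dots> \<le> avg m (\<lambda>v. avg n (\<lambda>w. ln (opnorm (word_mat E v)) + ln (opnorm (word_mat E w))))"
  proof (intro avg_mono)
    fix v w assume vw: "v \<in> words m" "w \<in> words n"
    then have "ln (opnorm (word_mat E (v @ w))) \<le> ln (opnorm (word_mat E v) * opnorm (word_mat E w))"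
      using opnorm_mult[of "word_mat E w" "word_mat E v"]
        opnorm_word_ge_1[OF append_in_words, of v m w n E]
      by (simp add: word_mat_append mult.commute)
    then show "ln (opnorm (word_mat E (v @ w))) \<le> ln (opnorm (word_mat E v)) + ln (opnorm (word_mat E w))"
      using opnorm_word_ge_1[OF vw(1), of E] opnorm_word_ge_1[OF vw(2), of E]
      by (simp add: ln_mult)
  qed
  finally show ?thesis by (simp add: avg_add mean_log_def)
qed

lemma mean_log_tendsto: "(\<lambda>n. mean_log n E / n) \<longlonglongrightarrow> (INF n\<in>{1..}. mean_log n E / n)"
  by (rule Fekete) (simp_all add: mean_log_subadd mean_log_nonneg)

end

subsection \<open>Square-integrable functions on the plane\<close>

text \<open>The preimage of a box is its image under the inverse \<open>B\<close>, whose determinant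
  is one, so the linear image formula returns the volume of the box; boxes determine
  \<open>lborel\<close>.\<close>

lemma lborel_distr_det_1:
  fixes A :: mat2
  assumes "det A = 1"
  shows "distr lborel borel ((*v) A) = lborel"
proof (rule lborel_eqI[symmetric])
  have "invertible A" using assms by (simp add: invertible_det_nz)
  then obtain B where B: "A ** B = mat 1" "B ** A = mat 1"
    unfolding invertible_def by blast
  have detB: "det B = 1" using B(2) det_mul[of B A] assms by simp
  have lin: "linear ((*v) B)" by simp
  fix l u :: "real^2" assume lu: "\<And>b. b \<in> Basis \<Longrightarrow> l \<bullet> b \<le> u \<bullet> b"
  have pre: "(*v) A -` box l u = (*v) B ` box l u"
  proof -
    have *: "A *v (B *v x) = x" "B *v (A *v x) = x" for x
      by (simp_all add: matrix_vector_mul_assoc B)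
    show ?thesis using * by (auto simp: image_iff) metis
  qed
  have meas: "(*v) A \<in> borel_measurable borel"
    by (intro borel_measurable_continuous_onI linear_continuous_on matrix_vector_mul_bounded_linear)
  have pre_sets: "(*v) A -` box l u \<in> sets borel"
    using measurable_sets[OF meas, of "box l u"] by simp
  have "emeasure (distr lborel borel ((*v) A)) (box l u) = emeasure lborel ((*v) A -` box l u)"
    using meas by (simp add: emeasure_distr)
  also have "\<dots> = emeasure lebesgue ((*v) B ` box l u)"
    using pre_sets unfolding pre by simp
  also have "\<dots> = ennreal (measure lebesgue ((*v) B ` box l u))"
    by (intro emeasure_eq_measure2 measurable_linear_image[OF lin]) simp
  also have "measure lebesgue ((*v) B ` box l u) = measure lebesgue (box l u)"
    by (subst measure_linear_image[OF lin]) (simp_all add: detB)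
  also have "ennreal (measure lebesgue (box l u)) = emeasure lborel (box l u)"
    using emeasure_bounded_finite[OF bounded_box, of l u]
    by (simp add: emeasure_eq_ennreal_measure less_top)
  also have "\<dots> = (\<Prod>b\<in>Basis. (u - l) \<bullet> b)"
    using lu by (simp add: emeasure_lborel_box_eq)
  finally show "emeasure (distr lborel borel ((*v) A)) (box l u) = (\<Prod>b\<in>Basis. (u - l) \<bullet> b)" .
qed simp

lemma borel_measurable_matrix_vector [measurable]:
  fixes A :: mat2 shows "(*v) A \<in> borel_measurable borel"
  by (intro borel_measurable_continuous_onI linear_continuous_on matrix_vector_mul_bounded_linear)

lemma lborel_integral_det_1:
  fixes f :: "real^2 \<Rightarrow> real"
  assumes "det A = 1" and [measurable]: "f \<in> borel_measurable borel"
  shows "(\<integral>x. f (A *v x) \<partial>lborel) = (\<integral>x. f x \<partial>lborel)"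
    and "integrable lborel (\<lambda>x. f (A *v x)) \<longleftrightarrow> integrable lborel f"
  using integral_distr[of "(*v) A" lborel borel f] integrable_distr_eq[of "(*v) A" lborel borel f]
  by (simp_all add: lborel_distr_det_1[OF assms(1)])

definition L2 :: "(real^2 \<Rightarrow> real) \<Rightarrow> bool" where
  "L2 f \<longleftrightarrow> f \<in> borel_measurable borel \<and> integrable lborel (\<lambda>x. (f x)\<^sup>2)"

definition normsq :: "(real^2 \<Rightarrow> real) \<Rightarrow> real" where
  "normsq f = (\<integral>x. (f x)\<^sup>2 \<partial>lborel)"

lemma L2_measurable: "L2 f \<Longrightarrow> f \<in> borel_measurable borel"
  by (simp add: L2_def)

lemma normsq_nonneg: "0 \<le> normsq f"
  unfolding normsq_def by simp

lemma L2_comp: "L2 f \<Longrightarrow> det A = 1 \<Longrightarrow> L2 (\<lambda>x. f (A *v x))"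
  unfolding L2_def
  using lborel_integral_det_1(2)[of A "\<lambda>x. (f x)\<^sup>2"] by (auto intro: measurable_compose)

lemma normsq_comp: "L2 f \<Longrightarrow> det A = 1 \<Longrightarrow> normsq (\<lambda>x. f (A *v x)) = normsq f"
  unfolding L2_def normsq_def
  using lborel_integral_det_1(1)[of A "\<lambda>x. (f x)\<^sup>2"] by auto

lemma L2_add:
  assumes "L2 f" "L2 g" shows "L2 (\<lambda>x. f x + g x)"
  unfolding L2_def
proof
  have [measurable]: "f \<in> borel_measurable borel" "g \<in> borel_measurable borel"
    using assms by (auto simp: L2_def)
  show "(\<lambda>x. f x + g x) \<in> borel_measurable borel" by measurable
  have "integrable lborel (\<lambda>x. 2 * (f x)\<^sup>2 + 2 * (g x)\<^sup>2)"
    using assms by (auto simp: L2_def)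
  then show "integrable lborel (\<lambda>x. (f x + g x)\<^sup>2)"
  proof (rule Bochner_Integration.integrable_bound)
    have "(f x + g x)\<^sup>2 \<le> 2 * (f x)\<^sup>2 + 2 * (g x)\<^sup>2" for x
      using zero_le_power2[of "f x - g x"] by (simp add: power2_eq_square algebra_simps)
    then show "AE x in lborel. norm ((f x + g x)\<^sup>2) \<le> norm (2 * (f x)\<^sup>2 + 2 * (g x)\<^sup>2)"
      by simp
  qed measurable
qed

lemma L2_cmult: "L2 f \<Longrightarrow> L2 (\<lambda>x. c * f x)"
  by (auto simp: L2_def power_mult_distrib)

lemma L2_diff: "L2 f \<Longrightarrow> L2 g \<Longrightarrow> L2 (\<lambda>x. f x - g x)"
  using L2_add[of f "\<lambda>x. (-1) * g x"] L2_cmult[of g "-1"] by simp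

lemma L2_zero: "L2 (\<lambda>x. 0)" by (simp add: L2_def)

lemma L2_sum: "(\<And>i. i \<in> I \<Longrightarrow> L2 (F i)) \<Longrightarrow> L2 (\<lambda>x. \<Sum>i\<in>I. F i x)"
  by (induction I rule: infinite_finite_induct) (auto simp: L2_zero intro!: L2_add)

lemma L2_cut: "L2 f \<Longrightarrow> Z \<in> sets borel \<Longrightarrow> integrable lborel (\<lambda>x. indicator Z x * (f x)\<^sup>2)"
  using integrable_real_mult_indicator[of Z lborel "\<lambda>x. (f x)\<^sup>2"]
  by (simp add: L2_def mult.commute)

section \<open>Cones away from the axes, and functions almost invariant under a diagonal
  matrix\<close>

definition sector :: "real \<Rightarrow> (real^2) set" where
  "sector R = {x. x$1 \<noteq> 0 \<and> \<bar>x$1\<bar> \<le> R * \<bar>x$2\<bar> \<and> \<bar>x$2\<bar> \<le> R * \<bar>x$1\<bar>}"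

lemma sector_sets [measurable]: "sector R \<in> sets borel"
  unfolding sector_def by measurable

text \<open>The difference telescopes into \<open>m\<close> increments. Cauchy-Schwarz costs one
  factor \<open>m\<close>; the other is the number of increments, all of equal norm because the
  matrix preserves Lebesgue measure.\<close>

lemma normsq_diag2_power:
  assumes f: "L2 f" and t: "t > 0"
  shows "normsq (\<lambda>x. f (diag2 (t ^ m) (1 / t ^ m) *v x) - f x)
    \<le> (real m)\<^sup>2 * normsq (\<lambda>x. f (diag2 t (1 / t) *v x) - f x)"
proof -
  define D where "D i = diag2 (t ^ i) (1 / t ^ i)" for i
  define h where "h = (\<lambda>x. f (D 1 *v x) - f x)"
  have det: "det (D i) = 1" for i using t by (simp add: D_def det_2)
  have h: "L2 h" unfolding h_def by (intro L2_diff L2_comp f det)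
  have D: "D 1 *v (D i *v x) = D (Suc i) *v x" for i x
    by (simp add: D_def matrix_vector_mul_assoc diag2_mult)
  have D0: "D 0 *v x = x" for x by (simp add: D_def vec2_eq_iff diag2_apply)
  have tele: "f (D m *v x) - f x = (\<Sum>i<m. h (D i *v x))" for x
    unfolding h_def D using sum_lessThan_telescope[of "\<lambda>i. f (D i *v x)" m] by (simp add: D0)
  have int: "integrable lborel (\<lambda>x. (h (D i *v x))\<^sup>2)" for i
    using L2_comp[OF h det] by (simp add: L2_def)
  have "normsq (\<lambda>x. f (D m *v x) - f x) \<le> (\<integral>x. (\<Sum>i<m. (h (D i *v x))\<^sup>2) * real m \<partial>lborel)"
    unfolding normsq_def
  proof (rule integral_mono)
    show "integrable lborel (\<lambda>x. (f (D m *v x) - f x)\<^sup>2)"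
      using L2_diff[OF L2_comp[OF f det] f, of m] by (simp add: L2_def)
    show "(f (D m *v x) - f x)\<^sup>2 \<le> (\<Sum>i<m. (h (D i *v x))\<^sup>2) * real m" for x
      unfolding tele using sum_squared_le_sum_of_squares[of "\<lambda>i. h (D i *v x)" "{..<m}"] by simp
  qed (use int in simp)
  also have "\<dots> = (\<Sum>i<m. normsq (\<lambda>x. h (D i *v x))) * real m"
    using int by (simp add: normsq_def)
  also have "\<dots> = (real m)\<^sup>2 * normsq h"
    by (simp add: normsq_comp[OF h det] power2_eq_square)
  finally show ?thesis by (simp add: D_def h_def)
qed

text \<open>The sector is wandering under a power of the diagonal matrix, so it carries little mass of a
  function that is almost invariant under that matrix.\<close>

lemma sector_mass_le:
  assumes t: "t > 1" and R: "R > 0"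
  obtains C where "C \<ge> 0"
    "\<And>g. L2 g \<Longrightarrow> (\<integral>x. indicator (sector R) x * (g x)\<^sup>2 \<partial>lborel)
       \<le> normsq g / 6 + C * normsq (\<lambda>x. g (diag2 t (1 / t) *v x) - g x)"
proof -
  \<comment> \<open>Absolute slopes in the sector lie between 1 / R and R, and the
    \<open>L\<close>-th power of the matrix divides slopes by t ^ (2 * L), which exceeds their
    largest ratio; so this power moves the sector off itself.\<close>
  obtain L where L: "R\<^sup>2 < t ^ L" using real_arch_pow[OF t] by blast
  \<comment> \<open>Twelve disjoint preimages of the sector are compared. Each comparison costs a
    factor 2 for splitting a square, which leaves 2 / 12 = 1 / 6 of the mass, so that three sectors
    in \<open>spectral_gap\<close> carry at most half of it plus an error. The powers involved are
    at most 12 * L.\<close>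
  define C where "C = 2 * (12 * real L)\<^sup>2"
  define D where "D j = diag2 (t ^ (j * L)) (1 / t ^ (j * L))" for j
  have det: "det (D i) = 1" for i using t by (simp add: D_def det_2)
  have wander: False if "i < j" "D i *v x \<in> sector R" "D j *v x \<in> sector R" for i j and x :: "real^2"
  proof -
    define s where "s = t ^ (i * L)"
    define r where "r = t ^ ((j - i) * L)"
    have sr: "t ^ (j * L) = s * r"
      using that(1) by (simp add: s_def r_def power_add[symmetric] algebra_simps)
    have s: "s > 0" and r1: "r \<ge> 1" using t by (simp_all add: s_def r_def)
    have "t ^ L \<le> r" unfolding r_def
      using that(1) t by (intro power_increasing) auto
    with L have r: "R\<^sup>2 < r" by simp
    have x1: "x$1 \<noteq> 0" and a: "\<bar>x$2\<bar> / s \<le> R * (s * \<bar>x$1\<bar>)"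
      using that(2) s by (auto simp: sector_def D_def diag2_apply s_def[symmetric] abs_mult)
    have b: "s * r * \<bar>x$1\<bar> \<le> R * (\<bar>x$2\<bar> / (s * r))"
      using that(3) s r1 by (auto simp: sector_def D_def diag2_apply sr abs_mult)
    have "s * r * \<bar>x$1\<bar> * r \<le> R * (\<bar>x$2\<bar> / s)"
      using b r1 s by (simp add: field_simps)
    also have "\<dots> \<le> R * (R * (s * \<bar>x$1\<bar>))" by (intro mult_left_mono a) (use R in auto)
    finally have "(s * \<bar>x$1\<bar>) * r\<^sup>2 \<le> (s * \<bar>x$1\<bar>) * R\<^sup>2" by (simp add: power2_eq_square ac_simps)
    then have "r\<^sup>2 \<le> R\<^sup>2" using s x1 by simp
    moreover have "r \<le> r\<^sup>2" using r1 by (simp add: power2_eq_square)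
    ultimately show False using r by simp
  qed
  show thesis
  proof (rule that[of C])
    show "C \<ge> 0" by (simp add: C_def)
    fix g :: "real^2 \<Rightarrow> real" assume g: "L2 g"
    note [measurable] = L2_measurable[OF g]
    define h where "h = (\<lambda>x. g (diag2 t (1 / t) *v x) - g x)"
    define I where "I = (\<integral>x. indicator (sector R) x * (g x)\<^sup>2 \<partial>lborel)"
    have pre: "{x. D j *v x \<in> sector R} \<in> sets borel" for j by measurable
    have intD: "integrable lborel (\<lambda>x. indicator (sector R) (D j *v x) * (g x)\<^sup>2)" for j
      using L2_cut[OF g pre[of j]] by (simp add: indicator_def)
    have intd: "integrable lborel (\<lambda>x. (g (D j *v x) - g x)\<^sup>2)" for j
      using L2_diff[OF L2_comp[OF g det] g] by (simp add: L2_def)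
    have I: "I \<le> 2 * (\<integral>x. indicator (sector R) (D j *v x) * (g x)\<^sup>2 \<partial>lborel) + C * normsq h"
      if j: "j < 12" for j
    proof -
      have "I = (\<integral>x. indicator (sector R) (D j *v x) * (g (D j *v x))\<^sup>2 \<partial>lborel)"
        unfolding I_def by (rule lborel_integral_det_1(1)[OF det, symmetric]) measurable
      also have "\<dots> \<le> (\<integral>x. 2 * (indicator (sector R) (D j *v x) * (g x)\<^sup>2) + 2 * (g (D j *v x) - g x)\<^sup>2 \<partial>lborel)"
      proof (rule integral_mono)
        show "integrable lborel (\<lambda>x. indicator (sector R) (D j *v x) * (g (D j *v x))\<^sup>2)"
          using L2_cut[OF L2_comp[OF g det[of j]] pre[of j]] by (simp add: indicator_def)
        show "integrable lborel (\<lambda>x. 2 * (indicator (sector R) (D j *v x) * (g x)\<^sup>2) + 2 * (g (D j *v x) - g x)\<^sup>2)"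
          using intD intd by simp
        fix x
        have "b\<^sup>2 \<le> 2 * a\<^sup>2 + 2 * (b - a)\<^sup>2" for a b :: real
          using zero_le_power2[of "2 * a - b"] by (simp add: power2_eq_square algebra_simps)
        then show "indicator (sector R) (D j *v x) * (g (D j *v x))\<^sup>2
            \<le> 2 * (indicator (sector R) (D j *v x) * (g x)\<^sup>2) + 2 * (g (D j *v x) - g x)\<^sup>2"
          by (auto simp: indicator_def)
      qed
      also have "\<dots> = 2 * (\<integral>x. indicator (sector R) (D j *v x) * (g x)\<^sup>2 \<partial>lborel)
          + 2 * normsq (\<lambda>x. g (D j *v x) - g x)"
        using intD intd by (simp add: normsq_def)
      also have "normsq (\<lambda>x. g (D j *v x) - g x) \<le> (real (j * L))\<^sup>2 * normsq h"
        unfolding D_def h_def using normsq_diag2_power[OF g, of t "j * L"] t by simp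
      also have "\<dots> \<le> (12 * real L)\<^sup>2 * normsq h"
        using j by (intro mult_right_mono power_mono normsq_nonneg) (auto intro!: mult_right_mono)
      finally show ?thesis by (simp add: C_def)
    qed
    have "12 * I = (\<Sum>j<12::nat. I)" by simp
    also have "\<dots> \<le> (\<Sum>j<12. 2 * (\<integral>x. indicator (sector R) (D j *v x) * (g x)\<^sup>2 \<partial>lborel) + C * normsq h)"
      by (intro sum_mono I) auto
    also have "\<dots> = 2 * (\<integral>x. (\<Sum>j<12. indicator (sector R) (D j *v x) * (g x)\<^sup>2) \<partial>lborel) + 12 * C * normsq h"
      using intD
      by (subst Bochner_Integration.integral_sum) (simp_all add: sum.distrib sum_distrib_left[symmetric])
    also have "(\<integral>x. (\<Sum>j<12. indicator (sector R) (D j *v x) * (g x)\<^sup>2) \<partial>lborel) \<le> normsq g"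
      unfolding normsq_def
    proof (rule integral_mono)
      show "integrable lborel (\<lambda>x. \<Sum>j<12. indicator (sector R) (D j *v x) * (g x)\<^sup>2)"
        by (intro Bochner_Integration.integrable_sum intD)
      show "integrable lborel (\<lambda>x. (g x)\<^sup>2)" using g by (simp add: L2_def)
      fix x
      have "(\<Sum>j<12. indicator (sector R) (D j *v x)) \<le> (1::real)"
      proof (cases "\<exists>j<12. D j *v x \<in> sector R")
        case True
        then obtain j where j: "j < 12" "D j *v x \<in> sector R" by blast
        have "(\<Sum>i<12. indicator (sector R) (D i *v x)) = (\<Sum>i<12. if i = j then 1 else 0 :: real)"
          using wander j by (intro sum.cong) (auto simp: indicator_def, metis linorder_neqE_nat)
        also have "\<dots> = 1" using j(1) by (subst sum.delta) simp_all
        finally show ?thesis by (rule eq_refl)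
      qed (simp add: indicator_def)
      then show "(\<Sum>j<12. indicator (sector R) (D j *v x) * (g x)\<^sup>2) \<le> (g x)\<^sup>2"
        by (simp add: sum_distrib_right[symmetric] mult_left_le_one_le sum_nonneg)
    qed
    finally show "(\<integral>x. indicator (sector R) x * (g x)\<^sup>2 \<partial>lborel)
       \<le> normsq g / 6 + C * normsq (\<lambda>x. g (diag2 t (1 / t) *v x) - g x)"
      by (simp add: I_def h_def)
  qed
qed

text \<open>Since the energy is nonzero, a vector near the horizontal axis has an image with
  coordinates of comparable size; one near the vertical axis is first sent near the horizontal one.
  The summands of \<open>R\<close> provide R >= 2, R >= 2 * \<bar>E\<bar> and R * \<bar>E\<bar> >= 3
  * a.\<close>

lemma sector_cover:
  assumes E: "E \<noteq> 0" and a: "a > 0" and x: "x \<noteq> 0"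
  defines "R \<equiv> 2 * \<bar>E\<bar> + 3 * real a / \<bar>E\<bar> + 2"
  shows "x \<in> sector R \<or> one_step E a *v x \<in> sector R \<or> one_step E a *v (one_step E a *v x) \<in> sector R"
proof -
  have a1: "real a \<ge> 1" using a by simp
  have pos: "3 * real a / \<bar>E\<bar> > 0" using E a by simp
  have R: "R \<ge> 2" "R \<ge> 2 * \<bar>E\<bar>" using pos by (auto simp: R_def)
  have RE: "R * \<bar>E\<bar> \<ge> 3 * real a"
  proof -
    have "R * \<bar>E\<bar> \<ge> (3 * real a / \<bar>E\<bar>) * \<bar>E\<bar>" by (intro mult_right_mono) (auto simp: R_def)
    then show ?thesis using E by simp
  qed
  have step: "(one_step E a *v y)$1 = (E * y$1 - y$2) / sqrt a"
    "(one_step E a *v y)$2 = sqrt a * y$1" for y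
    by (simp_all add: matrix_vector_2 diff_divide_distrib)
  have sq: "u / sqrt a \<le> c * (sqrt a * v) \<longleftrightarrow> u \<le> c * (a * v)"
    "sqrt a * v \<le> c * (u / sqrt a) \<longleftrightarrow> a * v \<le> c * u" for u v c :: real
  proof -
    have s: "sqrt a > 0" using a by simp
    have "sqrt a * sqrt a = a" by simp
    then show "u / sqrt a \<le> c * (sqrt a * v) \<longleftrightarrow> u \<le> c * (a * v)"
      "sqrt a * v \<le> c * (u / sqrt a) \<longleftrightarrow> a * v \<le> c * u"
      using s by (simp_all add: field_simps)
  qed
  \<comment> \<open>The threshold 2 * a is met both by vectors near the horizontal axis and by
    images of vectors near the vertical axis, so one estimate serves both cases below.\<close>
  have one: "one_step E a *v y \<in> sector R" if y: "R * \<bar>y$2\<bar> < 2 * real a * \<bar>y$1\<bar>" for y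
  proof -
    have y1: "y$1 \<noteq> 0" using y R by (auto simp: mult_less_0_iff)
    have e1: "\<bar>E * y$1 - y$2\<bar> \<le> \<bar>E\<bar> * \<bar>y$1\<bar> + \<bar>y$2\<bar>"
      by (metis abs_mult abs_triangle_ineq4)
    have e2: "\<bar>E * y$1 - y$2\<bar> \<ge> \<bar>E\<bar> * \<bar>y$1\<bar> - \<bar>y$2\<bar>"
      by (metis abs_mult abs_triangle_ineq2)
    have up: "\<bar>E * y$1 - y$2\<bar> \<le> R * (real a * \<bar>y$1\<bar>)"
    proof -
      have "2 * \<bar>y$2\<bar> \<le> R * \<bar>y$2\<bar>" using R by (intro mult_right_mono) auto
      with y have "\<bar>y$2\<bar> \<le> real a * \<bar>y$1\<bar>" by simp
      moreover have "\<bar>E\<bar> * \<bar>y$1\<bar> \<le> (R / 2) * \<bar>y$1\<bar>" using R by (intro mult_right_mono) auto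
      ultimately have "\<bar>E * y$1 - y$2\<bar> \<le> (R / 2 + real a) * \<bar>y$1\<bar>"
        using e1 by (simp add: algebra_simps)
      also have "\<dots> \<le> (R * real a) * \<bar>y$1\<bar>"
      proof (intro mult_right_mono)
        have "0 \<le> R * (real a - 1) + (R - 2) * real a" using R a1 by simp
        then show "R / 2 + real a \<le> R * real a" by (simp add: algebra_simps)
      qed auto
      finally show ?thesis by (simp add: ac_simps)
    qed
    have lo: "real a * \<bar>y$1\<bar> \<le> R * \<bar>E * y$1 - y$2\<bar>"
    proof -
      have "3 * real a * \<bar>y$1\<bar> \<le> R * \<bar>E\<bar> * \<bar>y$1\<bar>" by (intro mult_right_mono RE) auto
      moreover have "R * (\<bar>E\<bar> * \<bar>y$1\<bar> - \<bar>y$2\<bar>) \<le> R * \<bar>E * y$1 - y$2\<bar>"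
        by (intro mult_left_mono e2) (use R in auto)
      ultimately show ?thesis using y by (simp add: algebra_simps)
    qed
    have nz: "E * y$1 - y$2 \<noteq> 0" using lo y1 a by (auto simp: mult_le_0_iff)
    show ?thesis unfolding sector_def using up lo nz a by (simp add: step sq abs_mult del: times_divide_eq_right)
  qed
  consider "x \<in> sector R" | "R * \<bar>x$2\<bar> < \<bar>x$1\<bar>" | "R * \<bar>x$1\<bar> < \<bar>x$2\<bar>"
    using x R by (fastforce simp: sector_def vec2_eq_iff not_le)
  then show ?thesis
  proof cases
    case 2
    have "1 * \<bar>x$1\<bar> \<le> 2 * real a * \<bar>x$1\<bar>" using a1 by (intro mult_right_mono) auto
    with 2 show ?thesis using one[of x] by simp
  next
    case 3
    have "\<bar>E * x$1 - x$2\<bar> \<ge> \<bar>x$2\<bar> - \<bar>E\<bar> * \<bar>x$1\<bar>"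
      by (metis abs_minus_commute abs_mult abs_triangle_ineq2)
    moreover have "2 * \<bar>E\<bar> * \<bar>x$1\<bar> \<le> R * \<bar>x$1\<bar>" using R by (intro mult_right_mono) auto
    ultimately have *: "R * \<bar>x$1\<bar> < 2 * \<bar>E * x$1 - x$2\<bar>" using 3 by linarith
    have "sqrt a * (R * \<bar>x$1\<bar>) < sqrt a * (2 * \<bar>E * x$1 - x$2\<bar>)"
      using * a by (intro mult_strict_left_mono) auto
    also have "\<dots> = 2 * real a * (\<bar>E * x$1 - x$2\<bar> / sqrt a)"
      by (metis (no_types, lifting) mult.assoc mult.commute of_nat_0_le_iff real_div_sqrt times_divide_eq_right)
    finally show ?thesis using one[of "one_step E a *v x"] by (simp add: step abs_mult ac_simps)
  qed simp
qed

subsection \<open>Spectral gap and exponential growth\<close>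

context letters begin

text \<open>The right-hand side is the variance of \<open>F\<close>. Only the terms of
  \<open>u\<close> and \<open>v\<close> are kept, and the difference of the two values is split at
  the mean.\<close>

lemma avg_variance:
  assumes u: "u \<in> words n" and v: "v \<in> words n"
    and \<kappa>: "\<And>w. w \<in> words n \<Longrightarrow> \<kappa> \<le> wt w" "\<kappa> \<ge> 0"
  shows "\<kappa> / 2 * (F u - F v)\<^sup>2 \<le> avg n (\<lambda>w. (F w)\<^sup>2) - (avg n F)\<^sup>2"
proof -
  define m where "m = avg n F"
  have "avg n (\<lambda>w. (F w - m)\<^sup>2) = avg n (\<lambda>w. (F w)\<^sup>2 + ((- 2 * m) * F w + m\<^sup>2))"
    by (rule avg_cong) (simp add: power2_eq_square algebra_simps)
  also have "\<dots> = avg n (\<lambda>w. (F w)\<^sup>2) - m\<^sup>2"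
    unfolding avg_add avg_cmult avg_const by (simp add: m_def power2_eq_square)
  finally have var: "avg n (\<lambda>w. (F w - m)\<^sup>2) = avg n (\<lambda>w. (F w)\<^sup>2) - m\<^sup>2" .
  show ?thesis
  proof (cases "u = v")
    case True
    have "0 \<le> avg n (\<lambda>w. (F w - m)\<^sup>2)" by (rule avg_nonneg) simp
    then show ?thesis using True var by (simp add: m_def)
  next
    case False
    have "\<kappa> / 2 * (F u - F v)\<^sup>2 \<le> \<kappa> * ((F u - m)\<^sup>2 + (F v - m)\<^sup>2)"
    proof -
      have "(F u - F v)\<^sup>2 \<le> 2 * ((F u - m)\<^sup>2 + (F v - m)\<^sup>2)"
        using zero_le_power2[of "(F u - m) + (F v - m)"] by (simp add: power2_eq_square algebra_simps)
      then have "\<kappa> / 2 * (F u - F v)\<^sup>2 \<le> \<kappa> / 2 * (2 * ((F u - m)\<^sup>2 + (F v - m)\<^sup>2))"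
        by (intro mult_left_mono) (use \<kappa>(2) in auto)
      then show ?thesis by (simp add: algebra_simps)
    qed
    also have "\<dots> \<le> (\<Sum>w\<in>{u, v}. wt w * (F w - m)\<^sup>2)"
      using False \<kappa>(1)[OF u] \<kappa>(1)[OF v] by (simp add: distrib_left add_mono mult_right_mono)
    also have "\<dots> \<le> avg n (\<lambda>w. (F w - m)\<^sup>2)"
      unfolding avg_def using u v
      by (intro sum_mono2) (auto intro!: mult_nonneg_nonneg wt_nonneg)
    finally show ?thesis unfolding var by (simp only: m_def)
  qed
qed

lemma L2_avg:
  assumes "\<And>w. w \<in> words n \<Longrightarrow> L2 (F w)"
  shows "L2 (\<lambda>x. avg n (\<lambda>w. F w x))"
  unfolding avg_def by (intro L2_sum L2_cmult assms)

text \<open>Integrated form of \<open>avg_variance\<close>: every word contributes exactly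
  \<open>normsq f\<close> to the mean of the squares. A small loss of norm under averaging thus
  forces \<open>f\<close> to look alike along any two words.\<close>

lemma normsq_avg_gap:
  assumes f: "L2 f" and u: "u \<in> words n" and v: "v \<in> words n"
    and \<kappa>: "\<And>w. w \<in> words n \<Longrightarrow> \<kappa> \<le> wt w" "\<kappa> \<ge> 0"
  shows "\<kappa> / 2 * normsq (\<lambda>x. f (word_mat E u *v x) - f (word_mat E v *v x))
    \<le> normsq f - normsq (\<lambda>x. avg n (\<lambda>w. f (word_mat E w *v x)))"
proof -
  have L: "L2 (\<lambda>x. f (word_mat E w *v x))" if "w \<in> words n" for w
    by (intro L2_comp f det_word[OF that])
  have int: "integrable lborel (\<lambda>x. (f (word_mat E w *v x))\<^sup>2)" if "w \<in> words n" for w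
    using L[OF that] by (simp add: L2_def)
  have int1: "integrable lborel (\<lambda>x. avg n (\<lambda>w. (f (word_mat E w *v x))\<^sup>2))"
    unfolding avg_def using int by auto
  have int2: "integrable lborel (\<lambda>x. (avg n (\<lambda>w. f (word_mat E w *v x)))\<^sup>2)"
    using L2_avg[of n "\<lambda>w x. f (word_mat E w *v x)"] L by (simp add: L2_def)
  have "\<kappa> / 2 * normsq (\<lambda>x. f (word_mat E u *v x) - f (word_mat E v *v x))
    = (\<integral>x. \<kappa> / 2 * (f (word_mat E u *v x) - f (word_mat E v *v x))\<^sup>2 \<partial>lborel)"
    by (simp add: normsq_def)
  also have "\<dots> \<le> (\<integral>x. avg n (\<lambda>w. (f (word_mat E w *v x))\<^sup>2) - (avg n (\<lambda>w. f (word_mat E w *v x)))\<^sup>2 \<partial>lborel)"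
  proof (rule integral_mono)
    show "integrable lborel (\<lambda>x. \<kappa> / 2 * (f (word_mat E u *v x) - f (word_mat E v *v x))\<^sup>2)"
      using L2_diff[OF L[OF u] L[OF v]] by (simp add: L2_def)
    show "integrable lborel (\<lambda>x. avg n (\<lambda>w. (f (word_mat E w *v x))\<^sup>2) - (avg n (\<lambda>w. f (word_mat E w *v x)))\<^sup>2)"
      using int1 int2 by simp
  qed (rule avg_variance[OF u v \<kappa>])
  also have "\<dots> = (\<integral>x. avg n (\<lambda>w. (f (word_mat E w *v x))\<^sup>2) \<partial>lborel) - normsq (\<lambda>x. avg n (\<lambda>w. f (word_mat E w *v x)))"
    using int1 int2 by (simp add: normsq_def)
  also have "(\<integral>x. avg n (\<lambda>w. (f (word_mat E w *v x))\<^sup>2) \<partial>lborel) = avg n (\<lambda>w. normsq (\<lambda>x. f (word_mat E w *v x)))"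
    unfolding avg_def normsq_def using int by (subst Bochner_Integration.integral_sum) auto
  also have "\<dots> = avg n (\<lambda>w. normsq f)"
    by (rule avg_cong) (rule normsq_comp[OF f det_word])
  finally show ?thesis by simp
qed

text \<open>Words \<open>[b, b, a]\<close>, \<open>[b, a, b]\<close>, \<open>[a, b, b]\<close> differ from \<open>[b, b, b]\<close> by conjugates of the
  same hyperbolic diagonal matrix, so a function whose average over words of length three
  keeps its norm is almost invariant under all three conjugates; but the corresponding cones cover the plane.\<close>

lemma spectral_gap:
  assumes E: "E \<noteq> 0"
  obtains \<rho> where "0 < \<rho>" "\<rho> < 1"
    "\<And>f. L2 f \<Longrightarrow> normsq (\<lambda>x. avg 3 (\<lambda>w. f (word_mat E w *v x))) \<le> \<rho> * normsq f"
proof -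
  obtain a b where ab: "a \<in> set_pmf p" "b \<in> set_pmf p" "a < b" by (rule two_letters)
  have pos: "a > 0" "b > 0" using ab letter_pos by auto
  define t where "t = sqrt (b / a)"
  have t: "t > 1" using ab pos by (simp add: t_def)
  have tinv: "1 / t = sqrt (a / b)" by (simp add: t_def real_sqrt_divide)
  define R where "R = 2 * \<bar>E\<bar> + 3 * real b / \<bar>E\<bar> + 2"
  define A where "A = one_step E b"
  define D where "D = diag2 t (1 / t)"
  have R: "R > 0" using E pos by (simp add: R_def add_nonneg_pos)
  have detA: "det A = 1" using pos by (simp add: A_def det_one_step)
  have detD: "det D = 1" using t by (simp add: D_def det_2)
  have DA: "D *v (A *v x) = one_step E a *v x" for x
    using diag2_mult_one_step[OF pos, of E]
    by (simp add: D_def A_def tinv matrix_vector_mul_assoc) (simp add: t_def)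
  obtain C where C: "C \<ge> 0" and mass: "\<And>g. L2 g \<Longrightarrow> (\<integral>x. indicator (sector R) x * (g x)\<^sup>2 \<partial>lborel)
       \<le> normsq g / 6 + C * normsq (\<lambda>x. g (D *v x) - g x)"
    using sector_mass_le[OF t R] unfolding D_def by blast
  obtain \<kappa> where \<kappa>: "\<kappa> > 0" "\<kappa> \<le> 1" "\<And>w. w \<in> words 3 \<Longrightarrow> \<kappa> \<le> wt w"
    by (rule wt_lower_bound[of 3]) blast
  define K where "K = 12 * C / \<kappa> + 1"
  have K: "K \<ge> 1" using C \<kappa> by (simp add: K_def)
  \<comment> \<open>The argument ends with \<open>normsq f\<close> at most K times the loss of norm.
    The summand 1 in \<open>K\<close> makes the division by \<open>K\<close> safe, and the maximum
    with 1 / 2 keeps \<rho> positive when K = 1.\<close>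
  define \<rho> where "\<rho> = max (1 / 2) (1 - 1 / K)"
  show thesis
  proof (rule that[of \<rho>])
    show "0 < \<rho>" "\<rho> < 1" using K by (auto simp: \<rho>_def)
    fix f assume f: "L2 f"
    note [measurable] = L2_measurable[OF f]
    define V where "V = normsq f - normsq (\<lambda>x. avg 3 (\<lambda>w. f (word_mat E w *v x)))"
    have words: "[b, b, a] \<in> words 3" "[b, a, b] \<in> words 3" "[a, b, b] \<in> words 3" "[b, b, b] \<in> words 3"
      using ab by (auto simp: words_def)
    have app: "word_mat E [k, l, m] *v x = one_step E m *v (one_step E l *v (one_step E k *v x))" for k l m x
      by (simp add: matrix_vector_mul_assoc matrix_mul_assoc)
    have gap: "normsq (\<lambda>x. f (word_mat E u *v x) - f (A *v (A *v (A *v x)))) \<le> 2 / \<kappa> * V" if "u \<in> words 3" for u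
      using normsq_avg_gap[OF f that words(4) \<kappa>(3), of E] \<kappa>(1)
      by (simp add: V_def app A_def[symmetric] field_simps del: word_mat.simps)
    have LA: "L2 (\<lambda>x. g (A *v x))" "L2 (\<lambda>x. g (D *v x))" if "L2 g" for g
      by (rule L2_comp[OF that detA], rule L2_comp[OF that detD])
    have sub: "normsq g = normsq (\<lambda>x. g (A *v x))" if "L2 g" for g
      by (rule normsq_comp[OF that detA, symmetric])
    \<comment> \<open>Replacing the last, middle or first \<open>b\<close> of
      \<open>[b, b, b]\<close> by \<open>a\<close> inserts \<open>D\<close> after three, two or one
      factors \<open>A\<close>; this tests the invariance under \<open>D\<close> of
      \<open>f\<close>, \<open>g1\<close> and \<open>g2\<close> respectively.\<close>
    define g1 where "g1 = (\<lambda>x. f (A *v x))"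
    define g2 where "g2 = (\<lambda>x. f (A *v (A *v x)))"
    have g1: "L2 g1" unfolding g1_def by (rule LA(1)[OF f])
    have g2: "L2 g2" using LA(1)[OF g1] by (simp add: g1_def g2_def)
    have Lh: "L2 (\<lambda>x. g (D *v x) - g x)" if "L2 g" for g
      by (intro L2_diff LA that)
    have h0: "normsq (\<lambda>x. f (D *v x) - f x) \<le> 2 / \<kappa> * V"
      using gap[OF words(1)] sub[OF Lh[OF f]] sub[OF LA(1)[OF Lh[OF f]]]
        sub[OF LA(1)[OF LA(1)[OF Lh[OF f]]]]
      by (simp add: app DA A_def[symmetric] del: word_mat.simps)
    have h1: "normsq (\<lambda>x. g1 (D *v x) - g1 x) \<le> 2 / \<kappa> * V"
      using gap[OF words(2)] sub[OF Lh[OF g1]] sub[OF LA(1)[OF Lh[OF g1]]]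
      by (simp add: app DA A_def[symmetric] g1_def del: word_mat.simps)
    have h2: "normsq (\<lambda>x. g2 (D *v x) - g2 x) \<le> 2 / \<kappa> * V"
      using gap[OF words(3)] sub[OF Lh[OF g2]]
      by (simp add: app DA A_def[symmetric] g2_def del: word_mat.simps)
    have n1: "normsq g1 = normsq f" and n2: "normsq g2 = normsq f"
      using sub[OF f] sub[OF g1] by (simp_all add: g1_def g2_def)
    have int0: "integrable lborel (\<lambda>x. indicator (sector R) x * (g x)\<^sup>2)" if "L2 g" for g
      using L2_cut[OF that sector_sets] .
    have m1: "(\<lambda>x. indicator (sector R) x * (g1 x)\<^sup>2) \<in> borel_measurable borel"
      and m2: "(\<lambda>x. indicator (sector R) x * (f x)\<^sup>2) \<in> borel_measurable borel"
      using L2_measurable[OF g1] by measurable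
    note i1 = lborel_integral_det_1[OF detA m1]
    note i2 = lborel_integral_det_1[OF detA m2]
    have m2': "(\<lambda>x. indicator (sector R) (A *v x) * (f (A *v x))\<^sup>2) \<in> borel_measurable borel"
      by measurable
    note i3 = lborel_integral_det_1[OF detA m2']
    \<comment> \<open>The values of \<open>g2\<close> at x, of \<open>g1\<close> at A x and of
      \<open>f\<close> at A (A x) coincide, and for nonzero x one of these three points lies in the
      sector.\<close>
    have "normsq f = (\<integral>x. (g2 x)\<^sup>2 \<partial>lborel)" using n2 by (simp add: normsq_def)
    also have "\<dots> \<le> (\<integral>x. indicator (sector R) x * (g2 x)\<^sup>2 + indicator (sector R) (A *v x) * (g1 (A *v x))\<^sup>2
      + indicator (sector R) (A *v (A *v x)) * (f (A *v (A *v x)))\<^sup>2 \<partial>lborel)"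
    proof (rule integral_mono_AE)
      show "integrable lborel (\<lambda>x. (g2 x)\<^sup>2)" using g2 by (simp add: L2_def)
      show "integrable lborel (\<lambda>x. indicator (sector R) x * (g2 x)\<^sup>2 + indicator (sector R) (A *v x) * (g1 (A *v x))\<^sup>2
      + indicator (sector R) (A *v (A *v x)) * (f (A *v (A *v x)))\<^sup>2)"
        using int0[OF g2] int0[OF g1] int0[OF f] i1(2) i2(2) i3(2) by simp
      have "(g2 x)\<^sup>2 \<le> indicator (sector R) x * (g2 x)\<^sup>2 + indicator (sector R) (A *v x) * (g1 (A *v x))\<^sup>2
          + indicator (sector R) (A *v (A *v x)) * (f (A *v (A *v x)))\<^sup>2" if "x \<noteq> 0" for x
        using sector_cover[OF E pos(2) that]
        by (auto simp: g1_def g2_def A_def[symmetric] R_def[symmetric] indicator_def)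
      moreover have "AE x in lborel. x \<noteq> (0 :: real^2)"
        by (rule AE_lborel_singleton)
      ultimately show "AE x in lborel. (g2 x)\<^sup>2 \<le> indicator (sector R) x * (g2 x)\<^sup>2 + indicator (sector R) (A *v x) * (g1 (A *v x))\<^sup>2
          + indicator (sector R) (A *v (A *v x)) * (f (A *v (A *v x)))\<^sup>2"
        by (auto elim!: eventually_mono)
    qed
    also have "\<dots> = (\<integral>x. indicator (sector R) x * (g2 x)\<^sup>2 \<partial>lborel)
      + (\<integral>x. indicator (sector R) x * (g1 x)\<^sup>2 \<partial>lborel) + (\<integral>x. indicator (sector R) x * (f x)\<^sup>2 \<partial>lborel)"
      using int0[OF g2] int0[OF g1] int0[OF f] i1 i2 i3 by simp
    also have "\<dots> \<le> (normsq f / 6 + C * (2 / \<kappa> * V)) + (normsq f / 6 + C * (2 / \<kappa> * V))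
      + (normsq f / 6 + C * (2 / \<kappa> * V))"
      using mass[OF g2] mass[OF g1] mass[OF f] mult_left_mono[OF h0 C] mult_left_mono[OF h1 C]
        mult_left_mono[OF h2 C] unfolding n1 n2 by linarith
    finally have "normsq f \<le> 12 * C / \<kappa> * V" by simp
    moreover have V: "V \<ge> 0" using order_trans[OF normsq_nonneg h0] \<kappa>(1) by (simp add: zero_le_divide_iff)
    ultimately have "normsq f \<le> K * V" by (simp add: K_def algebra_simps)
    then have "1 / K * normsq f \<le> V" using K by (simp add: field_simps)
    then have "normsq (\<lambda>x. avg 3 (\<lambda>w. f (word_mat E w *v x))) \<le> (1 - 1 / K) * normsq f"
      by (simp add: V_def algebra_simps)
    also have "\<dots> \<le> \<rho> * normsq f"
      by (intro mult_right_mono normsq_nonneg) (simp add: \<rho>_def)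
    finally show "normsq (\<lambda>x. avg 3 (\<lambda>w. f (word_mat E w *v x))) \<le> \<rho> * normsq f" .
  qed
qed

text \<open>A product of norm at most \<sigma> ^ (-n) sends the disc of radius \<sigma> ^ n into the
  unit disc. With \<open>q\<close> the probability of such a norm, the averaged indicator is at
  least \<open>q\<close> on the small disc, whence q ^ 2 * \<sigma> ^ (2 * n) <= \<rho> ^ n; the
  fourth root of \<rho> balances both sides.\<close>

lemma small_norm_prob:
  assumes E: "E \<noteq> 0"
  obtains \<sigma> where "0 < \<sigma>" "\<sigma> < 1"
    "\<And>n. avg (3 * n) (\<lambda>w. of_bool (opnorm (word_mat E w) \<le> (1 / \<sigma>) ^ n)) \<le> \<sigma> ^ n"
proof -
  obtain \<rho> where \<rho>: "0 < \<rho>" "\<rho> < 1" and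
    gap: "\<And>f. L2 f \<Longrightarrow> normsq (\<lambda>x. avg 3 (\<lambda>w. f (word_mat E w *v x))) \<le> \<rho> * normsq f"
    using spectral_gap[OF E] by blast
  define \<sigma> where "\<sigma> = sqrt (sqrt \<rho>)"
  have \<sigma>: "0 < \<sigma>" "\<sigma> < 1" using \<rho> by (auto simp: \<sigma>_def)
  have "\<sigma>\<^sup>2 = sqrt \<rho>" using \<rho> by (simp add: \<sigma>_def)
  then have "(\<sigma>\<^sup>2)\<^sup>2 = \<rho>" using \<rho> by simp
  then have \<sigma>4: "\<sigma> ^ 4 = \<rho>" by simp
  define B :: "(real^2) set" where "B = cball 0 1"
  define vol where "vol = measure lborel B"
  have vol: "vol > 0" by (simp add: vol_def B_def)
  define F where "F n x = avg (3 * n) (\<lambda>w. indicator B (word_mat E w *v x))" for n x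
  have sq: "(indicator B x)\<^sup>2 = (indicator B x :: real)" for x by (simp add: indicator_def)
  have indB: "L2 (indicator B)"
    unfolding L2_def sq
    by (auto simp: B_def intro!: borel_measurable_indicator integrable_real_indicator emeasure_bounded_finite)
  have LF: "L2 (F n)" for n
    unfolding F_def[abs_def] by (intro L2_avg L2_comp[OF indB] det_word)
  have FSuc: "F (Suc n) = (\<lambda>x. avg 3 (\<lambda>v. F n (word_mat E v *v x)))" for n
  proof
    fix x
    have "F (Suc n) x = avg (3 + 3 * n) (\<lambda>w. indicator B (word_mat E w *v x))"
      by (simp add: F_def)
    then show "F (Suc n) x = avg 3 (\<lambda>v. F n (word_mat E v *v x))"
      by (simp add: avg_append F_def word_mat_append_apply)
  qed
  have F: "normsq (F n) \<le> \<rho> ^ n * vol" for n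
  proof (induction n)
    case 0
    show ?case by (simp add: F_def[abs_def] normsq_def vol_def sq)
  next
    case (Suc n)
    have "normsq (F (Suc n)) \<le> \<rho> * normsq (F n)" unfolding FSuc by (rule gap[OF LF])
    also have "\<dots> \<le> \<rho> * (\<rho> ^ n * vol)" using Suc \<rho> by (intro mult_left_mono) auto
    finally show ?case by (simp add: mult.assoc)
  qed
  show thesis
  proof (rule that[OF \<sigma>])
    fix n
    define q where "q = avg (3 * n) (\<lambda>w. of_bool (opnorm (word_mat E w) \<le> (1 / \<sigma>) ^ n))"
    have q: "q \<ge> 0" unfolding q_def by (rule avg_nonneg) simp
    define S :: "(real^2) set" where "S = cball 0 (\<sigma> ^ n)"
    have volS: "measure lborel S = (\<sigma> ^ n)\<^sup>2 * vol"
      using \<sigma> by (simp add: S_def vol_def B_def content_cball)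
    have Fq: "q \<le> F n x" if "x \<in> S" for x
      unfolding q_def F_def
    proof (rule avg_mono)
      fix w assume w: "w \<in> words (3 * n)"
      have "norm (word_mat E w *v x) \<le> 1" if le: "opnorm (word_mat E w) \<le> (1 / \<sigma>) ^ n"
      proof -
        have "norm (word_mat E w *v x) \<le> opnorm (word_mat E w) * norm x" by (rule norm_le_opnorm)
        also have "\<dots> \<le> (1 / \<sigma>) ^ n * \<sigma> ^ n"
          using le \<open>x \<in> S\<close> \<sigma> by (intro mult_mono) (auto simp: S_def)
        finally show ?thesis using \<sigma> by (simp add: power_one_over)
      qed
      then show "of_bool (opnorm (word_mat E w) \<le> (1 / \<sigma>) ^ n) \<le> (indicator B (word_mat E w *v x) :: real)"
        by (simp add: B_def indicator_def)
    qed
    have "q\<^sup>2 * measure lborel S = (\<integral>x. q\<^sup>2 * indicator S x \<partial>lborel)"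
      by (simp add: S_def)
    also have "\<dots> \<le> normsq (F n)"
      unfolding normsq_def
    proof (rule integral_mono)
      show "integrable lborel (\<lambda>x. q\<^sup>2 * indicat_real S x)"
        unfolding S_def by (intro integrable_mult_right integrable_real_indicator emeasure_bounded_finite) auto
      show "integrable lborel (\<lambda>x. (F n x)\<^sup>2)" using LF[of n] by (simp add: L2_def)
      show "q\<^sup>2 * indicator S x \<le> (F n x)\<^sup>2" for x
        using Fq[of x] q by (auto simp: indicator_def power_mono)
    qed
    also have "\<dots> \<le> \<rho> ^ n * vol" by (rule F)
    also have "\<rho> ^ n = (\<sigma> ^ n)\<^sup>2 * (\<sigma> ^ n)\<^sup>2"
      unfolding \<sigma>4[symmetric] by (simp flip: power_mult power_add)
    finally have "q\<^sup>2 * ((\<sigma> ^ n)\<^sup>2 * vol) \<le> (\<sigma> ^ n)\<^sup>2 * ((\<sigma> ^ n)\<^sup>2 * vol)"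
      by (simp add: volS mult.assoc)
    moreover have "(\<sigma> ^ n)\<^sup>2 * vol > 0" using \<sigma> vol by simp
    ultimately have "q\<^sup>2 \<le> (\<sigma> ^ n)\<^sup>2" by (simp only: mult_le_cancel_right_pos)
    then show "q \<le> \<sigma> ^ n" by (rule power2_le_imp_le) (use \<sigma> in simp)
  qed
qed

text \<open>For n > 0, outside an event of probability at most \<sigma> ^ n <= \<sigma> the
  logarithm is at least n * ln (1 / \<sigma>), and on the event it is nonnegative because the
  determinant is one.\<close>

lemma mean_log_linear:
  assumes E: "E \<noteq> 0"
  obtains c where "c > 0" "\<And>n. c * n \<le> mean_log (3 * n) E"
proof -
  obtain \<sigma> where \<sigma>: "0 < \<sigma>" "\<sigma> < 1" and
    prob: "\<And>n. avg (3 * n) (\<lambda>w. of_bool (opnorm (word_mat E w) \<le> (1 / \<sigma>) ^ n)) \<le> \<sigma> ^ n"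
    using small_norm_prob[OF E] by blast
  have ln\<sigma>: "ln (1 / \<sigma>) > 0" using \<sigma> by simp
  show thesis
  proof (rule that[of "(1 - \<sigma>) * ln (1 / \<sigma>)"])
    show "(1 - \<sigma>) * ln (1 / \<sigma>) > 0" using ln\<sigma> \<sigma>(2) by (intro mult_pos_pos) auto
    fix n
    show "(1 - \<sigma>) * ln (1 / \<sigma>) * n \<le> mean_log (3 * n) E"
    proof (cases "n = 0")
      case False
      let ?I = "\<lambda>w. of_bool (opnorm (word_mat E w) \<le> (1 / \<sigma>) ^ n) :: real"
      have "avg (3 * n) ?I \<le> \<sigma>"
        using prob[of n] power_decreasing[of 1 n \<sigma>] False \<sigma> by simp
      then have "(n * ln (1 / \<sigma>)) * (1 - \<sigma>) \<le> (n * ln (1 / \<sigma>)) * (1 - avg (3 * n) ?I)"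
        using ln\<sigma> by (intro mult_left_mono) auto
      also have "\<dots> = avg (3 * n) (\<lambda>w. (n * ln (1 / \<sigma>)) * (1 - ?I w))"
        by (simp only: avg_cmult avg_diff avg_const)
      also have "\<dots> \<le> mean_log (3 * n) E"
        unfolding mean_log_def
      proof (rule avg_mono)
        fix w assume w: "w \<in> words (3 * n)"
        show "(n * ln (1 / \<sigma>)) * (1 - ?I w) \<le> ln (opnorm (word_mat E w))"
        proof (cases "opnorm (word_mat E w) \<le> (1 / \<sigma>) ^ n")
          case True
          then show ?thesis using opnorm_word_ge_1[OF w, of E] by simp
        next
          case False
          have "n * ln (1 / \<sigma>) = ln ((1 / \<sigma>) ^ n)" using \<sigma> by (simp add: ln_realpow)
          also have "\<dots> \<le> ln (opnorm (word_mat E w))"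
            using False \<sigma> opnorm_word_ge_1[OF w, of E] by (subst ln_le_cancel_iff) auto
          finally show ?thesis using False by simp
        qed
      qed
      finally show ?thesis by (simp add: ac_simps)
    qed (simp add: mean_log_nonneg)
  qed
qed

end

subsection \<open>The action on lines\<close>

abbreviation line :: "real^2 \<Rightarrow> (real^2) set" where
  "line x \<equiv> span {x}"

abbreviation hor :: "(real^2) set" where "hor \<equiv> line (axis 1 1)"
abbreviation ver :: "(real^2) set" where "ver \<equiv> line (axis 2 1)"

lemma wedge_scale: "wedge x (c *\<^sub>R x) = 0"
  by (simp add: wedge_def)

lemma line_eq_iff:
  assumes "x \<noteq> 0" "y \<noteq> 0"
  shows "line x = line y \<longleftrightarrow> wedge x y = 0"
proof
  assume "line x = line y"
  then have "y \<in> line x" by (simp add: span_base)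
  then show "wedge x y = 0" by (auto simp: span_singleton wedge_scale)
next
  assume "wedge x y = 0"
  then obtain c where c: "y = c *\<^sub>R x" using wedge_eq_0_imp assms(1) by blast
  then have "c \<noteq> 0" using assms(2) by auto
  then show "line x = line y"
    using span_image_scale[of "{x}" "\<lambda>_. c"] c by simp
qed

lemma RP1_line: "x \<noteq> 0 \<Longrightarrow> line x \<in> RP1"
  by (simp add: RP1_def)

lemma RP1_obtain:
  assumes "V \<in> RP1" obtains x where "x \<noteq> 0" "V = line x"
proof -
  have V: "subspace V" "dim V = 1" using assms by (auto simp: RP1_def)
  obtain B where B: "B \<subseteq> V" "independent B" "V \<subseteq> span B" "card B = dim V"
    using basis_exists by blast
  then obtain x where x: "B = {x}" using V(2) by (metis card_1_singletonE)
  then have "V = line x" using B V(1) by (metis span_minimal subset_antisym)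
  moreover have "x \<noteq> 0" using B(2) x by auto
  ultimately show thesis using that by blast
qed

lemma act_line: "act M (line x) = line (M *v x)"
  unfolding act_def using span_linear_image[of "(*v) M" "{x}"] by simp

lemma act_mult: "act (A ** B) V = act A (act B V)"
  by (simp add: act_def image_image matrix_vector_mul_assoc)

lemma matrix_vector_nonzero: "det (A :: mat2) = 1 \<Longrightarrow> x \<noteq> 0 \<Longrightarrow> A *v x \<noteq> 0"
  using norm_le_opnorm_mult[of A x] by auto

lemma inj_act:
  assumes "det M = 1" shows "inj (act M)"
proof -
  have "inj ((*v) M)"
  proof (rule injI)
    fix x y assume "M *v x = M *v y"
    then have "M *v (x - y) = 0" by (simp add: matrix_vector_mult_diff_distrib)
    then show "x = y" using matrix_vector_nonzero[OF assms, of "x - y"] by auto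
  qed
  then show ?thesis by (auto simp: act_def inj_image_eq_iff intro!: injI)
qed

lemma act_RP1: "det M = 1 \<Longrightarrow> V \<in> RP1 \<Longrightarrow> act M V \<in> RP1"
  by (metis RP1_line RP1_obtain act_line matrix_vector_nonzero)

lemma diag2_power_mult:
  "t > 0 \<Longrightarrow> diag2 (t ^ Suc n) (1 / t ^ Suc n) = diag2 t (1 / t) ** diag2 (t ^ n) (1 / t ^ n)"
  by (simp add: vec2_eq_iff matrix_matrix_2)

text \<open>The n-th power divides slopes by t ^ (2 * n), so a line off both axes has an infinite
  orbit.\<close>

lemma diag2_invariant_lines:
  assumes t: "t > 1" and Z: "finite Z" "Z \<subseteq> RP1" and inv: "act (diag2 t (1 / t)) ` Z = Z"
  shows "Z \<subseteq> {hor, ver}"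
proof
  fix V assume V: "V \<in> Z"
  then obtain x where x: "x \<noteq> 0" "V = line x" using Z(2) RP1_obtain by blast
  define D where "D n = diag2 (t ^ n) (1 / t ^ n)" for n
  have det: "det (D n) = 1" for n using t by (simp add: D_def det_2)
  have orbit: "act (D n) V \<in> Z" for n
  proof (induction n)
    case 0
    have "D 0 = mat 1" by (simp add: D_def vec2_eq_iff mat_def)
    then show ?case using V by (simp add: act_def)
  next
    case (Suc n)
    have "act (D (Suc n)) V = act (diag2 t (1 / t)) (act (D n) V)"
      using t unfolding D_def by (subst diag2_power_mult) (simp_all add: act_mult)
    then show ?case using Suc inv by blast
  qed
  have "x$1 = 0 \<or> x$2 = 0"
  proof (rule ccontr)
    assume nz: "\<not> (x$1 = 0 \<or> x$2 = 0)"
    have "inj (\<lambda>n. act (D n) V)"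
    proof (rule injI)
      fix m n assume "act (D m) V = act (D n) V"
      then have "wedge (D m *v x) (D n *v x) = 0"
        using x det by (simp add: act_line line_eq_iff matrix_vector_nonzero)
      then have "(t ^ m / t ^ n - t ^ n / t ^ m) * (x$1 * x$2) = 0"
        by (simp add: wedge_def D_def matrix_vector_2 algebra_simps)
      then have "t ^ m / t ^ n = t ^ n / t ^ m" using nz by simp
      then have "(t ^ m)\<^sup>2 = (t ^ n)\<^sup>2" using t by (simp add: field_simps power2_eq_square)
      then have "t ^ m = t ^ n" using t by (subst (asm) power2_eq_iff_nonneg) auto
      then show "m = n" using t by simp
    qed
    then have "infinite (range (\<lambda>n. act (D n) V))" by (rule range_inj_infinite)
    moreover have "range (\<lambda>n. act (D n) V) \<subseteq> Z" using orbit by auto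
    ultimately show False using Z(1) finite_subset by blast
  qed
  then show "V \<in> {hor, ver}"
    using x by (auto simp: line_eq_iff wedge_def axis_def vec2_eq_iff)
qed

context letters begin

lemma det_letter [simp]: "a \<in> set_pmf p \<Longrightarrow> det (one_step E a) = 1"
  by (simp add: det_one_step letter_pos)

lemma act_ver: "a \<in> set_pmf p \<Longrightarrow> act (one_step E a) ver = hor"
proof -
  assume a: "a \<in> set_pmf p"
  have "one_step E a *v axis 2 1 \<noteq> 0" by (rule matrix_vector_nonzero) (auto simp: a axis_def vec2_eq_iff)
  then show ?thesis
    by (simp add: act_line line_eq_iff) (simp add: wedge_def matrix_vector_2 axis_def)
qed

lemma act_hor_ne: "a \<in> set_pmf p \<Longrightarrow> act (one_step E a) hor \<noteq> hor"
proof -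
  assume a: "a \<in> set_pmf p"
  have "one_step E a *v axis 1 1 \<noteq> 0" by (rule matrix_vector_nonzero) (auto simp: a axis_def vec2_eq_iff)
  then show ?thesis using letter_pos[OF a]
    by (simp add: act_line line_eq_iff) (simp add: wedge_def matrix_vector_2 axis_def)
qed

lemma act_hor_ne_ver: "a \<in> set_pmf p \<Longrightarrow> E \<noteq> 0 \<Longrightarrow> act (one_step E a) hor \<noteq> ver"
proof -
  assume a: "a \<in> set_pmf p" and E: "E \<noteq> 0"
  have "one_step E a *v axis 1 1 \<noteq> 0" by (rule matrix_vector_nonzero) (auto simp: a axis_def vec2_eq_iff)
  then show ?thesis using letter_pos[OF a] E
    by (simp add: act_line line_eq_iff) (simp add: wedge_def matrix_vector_2 axis_def)
qed

lemma hor_ne_ver: "hor \<noteq> ver"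
  by (simp add: line_eq_iff) (simp add: wedge_def axis_def)

lemma hyperbolic_quotient:
  obtains a b t where "a \<in> set_pmf p" "b \<in> set_pmf p" "t > 1"
    "\<And>E. diag2 t (1 / t) ** one_step E b = one_step E a"
proof -
  obtain a b where ab: "a \<in> set_pmf p" "b \<in> set_pmf p" "a < b" by (rule two_letters)
  then have pos: "a > 0" "b > 0" using letter_pos by auto
  have "1 / sqrt (b / a) = sqrt (a / b)" by (simp add: real_sqrt_divide)
  then show thesis
    using that[of a b "sqrt (b / a)"] ab pos diag2_mult_one_step[OF pos] by simp
qed

text \<open>The set \<open>W\<close> is invariant under the quotient of two letters. Allowing it to
  differ from \<open>Z\<close> covers consecutive levels of \<open>orbit\<close> as well as
  invariant sets.\<close>

lemma common_image_lines:
  assumes Z: "finite Z" "Z \<subseteq> RP1" and W: "\<And>a. a \<in> set_pmf p \<Longrightarrow> act (one_step E a) ` Z = W"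
  shows "W \<subseteq> {hor, ver}"
proof -
  obtain a b t where ab: "a \<in> set_pmf p" "b \<in> set_pmf p" "t > 1"
    and D: "\<And>E. diag2 t (1 / t) ** one_step E b = one_step E a" by (rule hyperbolic_quotient) blast
  have "act (diag2 t (1 / t)) ` W = act (one_step E a) ` Z"
    unfolding W[OF ab(2), symmetric] D[of E, symmetric] image_image act_mult ..
  then have "act (diag2 t (1 / t)) ` W = W" using W[OF ab(1)] by simp
  moreover have "finite W" "W \<subseteq> RP1" using W[OF ab(2)] Z ab(2) by (auto intro: act_RP1)
  ultimately show ?thesis using diag2_invariant_lines[OF ab(3)] by blast
qed

section \<open>The group generated by the letters\<close>

lemma one_step_in_G: "a \<in> set_pmf p \<Longrightarrow> one_step E a \<in> G_nu p E"
  by (auto simp: G_nu_def nu_def intro: generate.incl)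

lemma subgroup_G: "subgroup (G_nu p E) SL2"
  unfolding G_nu_def
  by (rule group.generate_is_subgroup[OF group_SL2])
    (auto simp: nu_def intro!: one_step_in_SL2 letter_pos)

lemma diag2_power_in_G:
  obtains t where "t > 1" "\<And>E n. diag2 (t ^ n) (1 / t ^ n) \<in> G_nu p E"
proof -
  obtain a b t where ab: "a \<in> set_pmf p" "b \<in> set_pmf p" "t > 1"
    and D: "\<And>E. diag2 t (1 / t) ** one_step E b = one_step E a" by (rule hyperbolic_quotient) blast
  interpret SL2: group SL2 by (rule group_SL2)
  have mult: "x \<otimes>\<^bsub>SL2\<^esub> y = x ** y" for x y by (simp add: SL2_def)
  show thesis
  proof (rule that[OF ab(3)])
    fix E n
    have c: "one_step E a \<in> carrier SL2" "one_step E b \<in> carrier SL2" "diag2 t (1 / t) \<in> carrier SL2"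
      using ab one_step_in_SL2 letter_pos by (auto simp: SL2_def det_2)
    have "diag2 t (1 / t) = one_step E a \<otimes>\<^bsub>SL2\<^esub> inv\<^bsub>SL2\<^esub> one_step E b"
      using c D[of E] by (metis SL2.inv_solve_right mult)
    then have D: "diag2 t (1 / t) \<in> G_nu p E"
      using subgroup_G ab by (metis one_step_in_G subgroup.m_closed subgroup.m_inv_closed)
    show "diag2 (t ^ n) (1 / t ^ n) \<in> G_nu p E"
    proof (induction n)
      case 0
      have "diag2 (t ^ 0) (1 / t ^ 0) = \<one>\<^bsub>SL2\<^esub>" by (simp add: SL2_def vec2_eq_iff mat_def)
      then show ?case using subgroup_G subgroup.one_closed by metis
    next
      case (Suc n)
      have "diag2 (t ^ Suc n) (1 / t ^ Suc n) = diag2 t (1 / t) \<otimes>\<^bsub>SL2\<^esub> diag2 (t ^ n) (1 / t ^ n)"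
        unfolding mult using ab(3) by (intro diag2_power_mult) simp
      then show ?case using Suc D subgroup_G subgroup.m_closed by metis
    qed
  qed
qed

lemma not_compact_G: "\<not> compact (G_nu p E)"
proof
  assume "compact (G_nu p E)"
  then obtain B where B: "\<And>M. M \<in> G_nu p E \<Longrightarrow> norm M \<le> B"
    using compact_imp_bounded bounded_iff by metis
  obtain t where t: "t > 1" "\<And>E n. diag2 (t ^ n) (1 / t ^ n) \<in> G_nu p E"
    by (rule diag2_power_in_G) blast
  obtain n where n: "B < t ^ n" using real_arch_pow[OF t(1)] by blast
  let ?M = "diag2 (t ^ n) (1 / t ^ n)"
  have "t ^ n \<le> norm (?M $ 1)" using component_le_norm_cart[of "?M $ 1" 1] t(1) by simp
  also have "\<dots> \<le> norm ?M" by (rule Finite_Cartesian_Product.norm_nth_le)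
  also have "\<dots> \<le> B" by (intro B t)
  finally show False using n by simp
qed

text \<open>Normalised powers of the hyperbolic quotient converge to the projection onto the
  horizontal axis.\<close>

lemma contracting_G: "contracting (G_nu p E)"
proof -
  obtain t where t: "t > 1" "\<And>E n. diag2 (t ^ n) (1 / t ^ n) \<in> G_nu p E"
    by (rule diag2_power_in_G) blast
  have "opnorm (diag2 (t ^ n) (1 / t ^ n)) = t ^ n" for n
  proof -
    have "1 / t ^ n \<le> 1" "1 \<le> t ^ n" using t(1) by auto
    then have "1 / t ^ n \<le> t ^ n" by linarith
    then show ?thesis using t(1) by (simp add: opnorm_diag2 max_def)
  qed
  then have eq: "inverse (opnorm (diag2 (t ^ n) (1 / t ^ n))) *\<^sub>R diag2 (t ^ n) (1 / t ^ n)
      = diag2 1 ((1 / t\<^sup>2) ^ n)" for n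
    using t(1) by (simp add: vec2_eq_iff field_simps power2_eq_square power_mult_distrib)
  have lim: "(\<lambda>n. (1 / t\<^sup>2) ^ n) \<longlonglongrightarrow> 0"
    by (rule LIMSEQ_realpow_zero) (use t(1) in auto)
  have "(\<lambda>n. diag2 1 ((1 / t\<^sup>2) ^ n)) \<longlonglongrightarrow> diag2 1 0"
  proof (intro vec_tendstoI)
    fix i j :: 2
    show "(\<lambda>n. diag2 1 ((1 / t\<^sup>2) ^ n) $ i $ j) \<longlonglongrightarrow> diag2 1 0 $ i $ j"
      using exhaust_2[of i] exhaust_2[of j] lim by auto
  qed
  moreover have "rank (diag2 1 0) = 1"
  proof -
    have "range ((*v) (diag2 1 0)) = hor"
    proof (intro equalityI subsetI)
      fix y assume "y \<in> range ((*v) (diag2 1 0))"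
      then obtain x where "y = diag2 1 0 *v x" by auto
      then have "y = x$1 *\<^sub>R axis 1 1" by (simp add: vec2_eq_iff matrix_vector_2 axis_def)
      then show "y \<in> hor" by (auto simp: span_singleton)
    next
      fix y assume "y \<in> hor"
      then have "y = diag2 1 0 *v y" by (auto simp: span_singleton vec2_eq_iff matrix_vector_2 axis_def)
      then show "y \<in> range ((*v) (diag2 1 0))" by blast
    qed
    then show ?thesis by (simp add: rank_dim_range)
  qed
  ultimately show ?thesis unfolding contracting_def
    by (intro exI[of _ "\<lambda>n. diag2 (t ^ n) (1 / t ^ n)"] conjI exI[of _ "diag2 1 0"] allI t(2)) (simp_all add: eq)
qed

lemma strongly_irreducible_G:
  assumes "E \<noteq> 0" shows "strongly_irreducible (G_nu p E)"
  unfolding strongly_irreducible_def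
proof (rule notI, elim exE conjE)
  fix F assume F: "F \<subseteq> RP1" "finite F" "F \<noteq> {}" "\<forall>M\<in>G_nu p E. act M ` F = F"
  obtain a where a: "a \<in> set_pmf p" using two_letters by blast
  have sub: "F \<subseteq> {hor, ver}"
    by (rule common_image_lines[of F E]) (use F one_step_in_G in auto)
  have A: "act (one_step E a) ` F = F" using F(4) one_step_in_G[OF a] by blast
  then have "hor \<notin> F"
    using sub act_hor_ne[OF a, of E] act_hor_ne_ver[OF a assms] by blast
  then show False using F(3) sub A act_ver[OF a, of E] by blast
qed

text \<open>At energy zero the pair of axes is invariant, but its members are exchanged; neither
  axis is fixed by a letter at any energy.\<close>

lemma no_invariant_line: "{V \<in> RP1. \<forall>M\<in>G_nu p E. act M V = V} = {}"
proof (rule equals0I)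
  fix V assume V: "V \<in> {V \<in> RP1. \<forall>M\<in>G_nu p E. act M V = V}"
  obtain a where a: "a \<in> set_pmf p" using two_letters by blast
  have "{V} \<subseteq> {hor, ver}"
    by (rule common_image_lines[of "{V}" E]) (use V one_step_in_G in auto)
  moreover have "act (one_step E a) V = V" using V one_step_in_G[OF a] by blast
  ultimately show False using act_hor_ne[OF a, of E] act_ver[OF a, of E] hor_ne_ver by auto
qed

section \<open>Growth of orbits of lines and hitting probabilities\<close>

definition orbit :: "real \<Rightarrow> (real^2) set \<Rightarrow> nat \<Rightarrow> (real^2) set set" where
  "orbit E V n = (\<lambda>w. act (word_mat E w) V) ` words n"

lemma finite_orbit [simp]: "finite (orbit E V n)"
  by (simp add: orbit_def)

lemma orbit_RP1: "V \<in> RP1 \<Longrightarrow> orbit E V n \<subseteq> RP1"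
  by (auto simp: orbit_def intro!: act_RP1)

lemma act_orbit_subset:
  assumes "a \<in> set_pmf p" shows "act (one_step E a) ` orbit E V n \<subseteq> orbit E V (Suc n)"
proof -
  have "act (one_step E a) (act (word_mat E w) V) \<in> orbit E V (Suc n)" if "w \<in> words n" for w
  proof -
    have "w @ [a] \<in> words (n + 1)" using that assms by (intro append_in_words) (auto simp: words_def)
    then have "act (word_mat E (w @ [a])) V \<in> orbit E V (Suc n)" by (auto simp: orbit_def)
    then show ?thesis by (simp add: word_mat_append act_mult)
  qed
  then show ?thesis by (auto simp: orbit_def)
qed

lemma card_act_orbit: "a \<in> set_pmf p \<Longrightarrow> card (act (one_step E a) ` orbit E V n) = card (orbit E V n)"
  by (rule card_image) (meson inj_act inj_on_subset det_letter subset_UNIV)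

lemma card_orbit_mono: "card (orbit E V n) \<le> card (orbit E V (Suc n))"
proof -
  obtain a where a: "a \<in> set_pmf p" using two_letters by blast
  show ?thesis
    using card_mono[OF _ act_orbit_subset[OF a, of E V n]] card_act_orbit[OF a] by simp
qed

text \<open>Letters act injectively on lines, so without growth each letter maps level
  \<open>n\<close> onto level \<open>Suc n\<close>, which is then a common image.\<close>

lemma card_orbit_eq:
  assumes V: "V \<in> RP1" and eq: "card (orbit E V (Suc n)) = card (orbit E V n)"
  shows "orbit E V (Suc n) \<subseteq> {hor, ver}"
    "a \<in> set_pmf p \<Longrightarrow> act (one_step E a) ` orbit E V n = orbit E V (Suc n)"
proof -
  show *: "act (one_step E a) ` orbit E V n = orbit E V (Suc n)" if "a \<in> set_pmf p" for a
    by (rule card_subset_eq) (use act_orbit_subset[OF that] card_act_orbit[OF that] eq in auto)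
  show "orbit E V (Suc n) \<subseteq> {hor, ver}"
    by (rule common_image_lines[OF finite_orbit orbit_RP1[OF V] *])
qed

text \<open>If three steps bring no growth, the next three levels consist of axes. The horizontal
  axis cannot occur in the first two of them, as its image is not an axis; so the first is the
  vertical axis alone, whose image is horizontal and lies in the second.\<close>

lemma card_orbit_less:
  assumes E: "E \<noteq> 0" and V: "V \<in> RP1"
  shows "card (orbit E V n) < card (orbit E V (n + 3))"
proof (rule ccontr)
  assume "\<not> ?thesis"
  moreover have "card (orbit E V n) \<le> card (orbit E V (n+1))"
    "card (orbit E V (n+1)) \<le> card (orbit E V (n+2))" "card (orbit E V (n+2)) \<le> card (orbit E V (n+3))"
    using card_orbit_mono[of E V n] card_orbit_mono[of E V "n+1"] card_orbit_mono[of E V "n+2"]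
    by (simp_all add: numeral_eq_Suc)
  ultimately have eq: "card (orbit E V (Suc n)) = card (orbit E V n)"
      "card (orbit E V (Suc (Suc n))) = card (orbit E V (Suc n))"
      "card (orbit E V (Suc (Suc (Suc n)))) = card (orbit E V (Suc (Suc n)))"
    by (simp_all add: numeral_eq_Suc)
  obtain a where a: "a \<in> set_pmf p" using two_letters by blast
  let ?O = "\<lambda>n. orbit E V n"
  have s: "?O (Suc n) \<subseteq> {hor, ver}" "?O (Suc (Suc n)) \<subseteq> {hor, ver}" "?O (Suc (Suc (Suc n))) \<subseteq> {hor, ver}"
    by (intro card_orbit_eq(1)[OF V] eq)+
  have i: "act (one_step E a) ` ?O (Suc n) = ?O (Suc (Suc n))"
    "act (one_step E a) ` ?O (Suc (Suc n)) = ?O (Suc (Suc (Suc n)))"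
    by (intro card_orbit_eq(2)[OF V _ a] eq)+
  have nh: "hor \<notin> ?O (Suc n)" "hor \<notin> ?O (Suc (Suc n))"
    using s(2,3) i act_hor_ne[OF a, of E] act_hor_ne_ver[OF a E] by blast+
  have "words (Suc n) \<noteq> {}" using sum_wt[of "Suc n"] by auto
  then have "?O (Suc n) \<noteq> {}" by (auto simp: orbit_def)
  then have "ver \<in> ?O (Suc n)" using s(1) nh(1) by blast
  then have "hor \<in> ?O (Suc (Suc n))" using i(1) act_ver[OF a, of E] by blast
  then show False using nh(2) by blast
qed

lemma card_orbit_ge:
  assumes "E \<noteq> 0" "V \<in> RP1" shows "N < card (orbit E V (3 * N))"
proof (induction N)
  case 0
  then show ?case by (simp add: orbit_def)
next
  case (Suc N)
  then show ?case using card_orbit_less[OF assms, of "3 * N"] by (simp add: add.commute)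
qed

definition hit :: "real \<Rightarrow> nat \<Rightarrow> (real^2) set \<Rightarrow> (real^2) set \<Rightarrow> real" where
  "hit E n V V' = avg n (\<lambda>w. of_bool (act (word_mat E w) V = V'))"

lemma hit_append: "hit E (m + n) V V' = avg m (\<lambda>v. hit E n (act (word_mat E v) V) V')"
  by (simp add: hit_def avg_append word_mat_append act_mult)

text \<open>Each word sends at most one line to \<open>V'\<close>.\<close>

lemma sum_hit_le: "finite Z \<Longrightarrow> (\<Sum>V\<in>Z. hit E n V V') \<le> 1"
proof -
  assume Z: "finite Z"
  have "(\<Sum>V\<in>Z. hit E n V V') = avg n (\<lambda>w. \<Sum>V\<in>Z. of_bool (act (word_mat E w) V = V'))"
    by (simp only: hit_def avg_sum)
  also have "\<dots> \<le> 1"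
  proof (rule avg_le_const)
    fix w assume w: "w \<in> words n"
    have "card (Z \<inter> {V. act (word_mat E w) V = V'}) \<le> Suc 0"
      using inj_act[OF det_word[OF w], of E] Z by (subst card_le_Suc0_iff_eq) (auto dest: injD)
    then show "(\<Sum>V\<in>Z. of_bool (act (word_mat E w) V = V')) \<le> (1::real)"
      using Z by (simp add: sum_of_bool_eq)
  qed
  finally show ?thesis .
qed

text \<open>Among the more than \<open>N\<close> lines reachable from \<open>V\<close> one has
  hitting probability at most 1 / N, by \<open>sum_hit_le\<close>. A word leading to it has weight
  at least \<kappa>; for all other words the bound \<open>q\<close> is used.\<close>

lemma hit_step:
  assumes E: "E \<noteq> 0" and N: "N > 0" and V: "V \<in> RP1"
    and \<kappa>: "\<And>w. w \<in> words (3 * N) \<Longrightarrow> \<kappa> \<le> wt w"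
    and q: "\<And>V. V \<in> RP1 \<Longrightarrow> hit E n V V' \<le> q" and qN: "1 / N \<le> q"
  shows "hit E (3 * N + n) V V' \<le> \<kappa> / N + (1 - \<kappa>) * q"
proof -
  let ?Z = "orbit E V (3 * N)"
  have "\<exists>U\<in>?Z. hit E n U V' \<le> 1 / N"
  proof (rule ccontr)
    assume "\<not> ?thesis"
    then have "(\<Sum>U\<in>?Z. 1 / real N) \<le> (\<Sum>U\<in>?Z. hit E n U V')"
      by (intro sum_mono) auto
    also have "\<dots> \<le> 1" by (rule sum_hit_le) simp
    finally have "card ?Z \<le> N" using N by (simp add: field_simps)
    then show False using card_orbit_ge[OF E V, of N] by simp
  qed
  then obtain u where u: "u \<in> words (3 * N)" "hit E n (act (word_mat E u) V) V' \<le> 1 / N"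
    by (auto simp: orbit_def)
  have "hit E (3 * N + n) V V' \<le> avg (3 * N) (\<lambda>v. if v = u then 1 / N else q)"
    unfolding hit_append using u by (intro avg_mono) (auto intro!: q act_RP1 V)
  also have "\<dots> = avg (3 * N) (\<lambda>v. q - (q - 1 / N) * of_bool (v = u))"
    by (intro avg_cong) auto
  also have "\<dots> = q - (q - 1 / N) * avg (3 * N) (\<lambda>v. of_bool (v = u))"
    by (simp only: avg_diff avg_cmult avg_const)
  also have "avg (3 * N) (\<lambda>v. of_bool (v = u)) = wt u"
    using u(1) by (simp add: avg_def of_bool_def if_distrib cong: if_cong)
  also have "q - (q - 1 / N) * wt u \<le> q - (q - 1 / N) * \<kappa>"
    using \<kappa>[OF u(1)] qN by (intro diff_left_mono mult_left_mono) auto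
  finally show ?thesis by (simp add: algebra_simps)
qed

text \<open>The recursion of \<open>hit_step\<close> contracts to its fixed point 1 / N at rate 1 -
  \<kappa>. The length obtained is uniform in both lines.\<close>

lemma hit_small:
  assumes E: "E \<noteq> 0" and "\<eta> > 0"
  obtains n where "\<And>V V'. V \<in> RP1 \<Longrightarrow> hit E n V V' \<le> \<eta>"
proof -
  obtain N :: nat where N: "N > 0" "2 / \<eta> < N" using reals_Archimedean2[of "2 / \<eta>"] \<open>\<eta> > 0\<close>
    by (metis divide_pos_pos of_nat_0_less_iff order_less_trans zero_less_numeral)
  obtain \<kappa> where \<kappa>: "\<kappa> > 0" "\<kappa> \<le> 1" "\<And>w. w \<in> words (3 * N) \<Longrightarrow> \<kappa> \<le> wt w"
    by (rule wt_lower_bound[of "3 * N"]) blast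
  have *: "hit E (r * (3 * N)) V V' \<le> 1 / N + (1 - \<kappa>) ^ r" if "V \<in> RP1" for r V V'
    using that
  proof (induction r arbitrary: V)
    case 0
    have "hit E 0 V V' \<le> 1" by (simp add: hit_def)
    then show ?case using N by (simp add: add_increasing)
  next
    case (Suc r)
    have "hit E (3 * N + r * (3 * N)) V V' \<le> \<kappa> / N + (1 - \<kappa>) * (1 / N + (1 - \<kappa>) ^ r)"
      by (rule hit_step[OF E N(1) Suc.prems \<kappa>(3) Suc.IH]) (use \<kappa> in auto)
    then show ?case by (simp add: algebra_simps diff_divide_distrib)
  qed
  obtain r where r: "(1 - \<kappa>) ^ r < 1 / N"
    using real_arch_pow_inv[of "1 / N" "1 - \<kappa>"] N \<kappa>(1) by auto
  have "1 / N + (1 - \<kappa>) ^ r \<le> \<eta>"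
    using r N \<open>\<eta> > 0\<close> by (simp add: field_simps)
  then show thesis by (intro that[of "r * (3 * N)"] order_trans[OF *])
qed

end

subsection \<open>Semicontinuity of the Lyapunov exponent\<close>

context letters begin

text \<open>If all words of a set \<open>W\<close> sent x into one line, that line would be hit with
  probability above \<eta>. So the sum of the wedges over pairs from \<open>W\<close> is positive,
  and by compactness of the circle bounded below. Uniformity in \<open>W\<close> matters because the
  set to which this is applied depends on the later letters.\<close>

lemma separated_images:
  assumes E: "E \<noteq> 0" and \<eta>: "\<eta> > 0"
  obtains k \<delta> where "\<delta> > 0"
    "\<And>x W. norm x = 1 \<Longrightarrow> W \<subseteq> words k \<Longrightarrow> \<eta> < avg k (\<lambda>w. of_bool (w \<in> W)) \<Longrightarrow>
       \<exists>u\<in>W. \<exists>v\<in>W. \<delta> \<le> \<bar>wedge (word_mat E u *v x) (word_mat E v *v x)\<bar>"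
proof -
  obtain k where k: "\<And>V V'. V \<in> RP1 \<Longrightarrow> hit E k V V' \<le> \<eta>" using hit_small[OF E \<eta>] by blast
  define P where "P W \<delta> \<longleftrightarrow> \<delta> > 0 \<and> (\<forall>x. norm x = 1 \<longrightarrow>
      (\<exists>u\<in>W. \<exists>v\<in>W. \<delta> \<le> \<bar>wedge (word_mat E u *v x) (word_mat E v *v x)\<bar>))" for W and \<delta> :: real
  define Q where "Q = {W. W \<subseteq> words k \<and> \<eta> < avg k (\<lambda>w. of_bool (w \<in> W))}"
  have finQ: "finite Q" unfolding Q_def by (rule finite_subset[of _ "Pow (words k)"]) auto
  have "\<exists>\<delta>. P W \<delta>" if W: "W \<in> Q" for W
  proof -
    have Wk: "W \<subseteq> words k" and Wp: "\<eta> < avg k (\<lambda>w. of_bool (w \<in> W))" using W by (auto simp: Q_def)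
    have finW: "finite W" using Wk finite_subset finite_words by blast
    have "W \<noteq> {}" using Wp \<eta> by auto
    then obtain u0 where u0: "u0 \<in> W" by blast
    define \<phi> where "\<phi> x = (\<Sum>(u, v)\<in>W \<times> W. \<bar>wedge (word_mat E u *v x) (word_mat E v *v x)\<bar>)" for x
    have "continuous_on (sphere 0 1) \<phi>"
      unfolding \<phi>_def wedge_def matrix_vector_2 case_prod_unfold by (intro continuous_intros)
    moreover have "sphere (0 :: real^2) 1 \<noteq> {}" by simp
    ultimately obtain x0 where x0: "norm x0 = 1" "\<And>x. norm x = 1 \<Longrightarrow> \<phi> x0 \<le> \<phi> x"
      using continuous_attains_inf[of "sphere 0 1" \<phi>] by auto
    have nx: "x0 \<noteq> 0" using x0(1) by force
    have nz: "word_mat E u *v x0 \<noteq> 0" if "u \<in> words k" for u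
      by (rule matrix_vector_nonzero[OF det_word[OF that] nx])
    have "\<phi> x0 > 0"
    proof (rule ccontr)
      assume "\<not> \<phi> x0 > 0"
      moreover have "\<phi> x0 \<ge> 0" unfolding \<phi>_def by (intro sum_nonneg) auto
      ultimately have "\<phi> x0 = 0" by simp
      then have z: "wedge (word_mat E u *v x0) (word_mat E v *v x0) = 0" if "u \<in> W" "v \<in> W" for u v
        using that finW unfolding \<phi>_def by (subst (asm) sum_nonneg_eq_0_iff) auto
      have "avg k (\<lambda>w. of_bool (w \<in> W)) \<le> hit E k (line x0) (line (word_mat E u0 *v x0))"
        unfolding hit_def
      proof (rule avg_mono)
        fix w assume w: "w \<in> words k"
        have "act (word_mat E w) (line x0) = line (word_mat E u0 *v x0)" if "w \<in> W"
          using z[OF that u0] nx nz w u0 Wk by (simp add: act_line line_eq_iff subset_iff)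
        then show "of_bool (w \<in> W) \<le> (of_bool (act (word_mat E w) (line x0) = line (word_mat E u0 *v x0)) :: real)"
          by simp
      qed
      also have "\<dots> \<le> \<eta>" using nx by (intro k RP1_line)
      finally show False using Wp by simp
    qed
    define n where "n = card (W \<times> W)"
    have n: "n > 0" using finW u0 by (auto simp: n_def card_gt_0_iff)
    have "P W (\<phi> x0 / n)"
      unfolding P_def
    proof (intro conjI allI impI)
      show "\<phi> x0 / n > 0" using \<open>\<phi> x0 > 0\<close> n by simp
      fix x :: "real^2" assume x: "norm x = 1"
      show "\<exists>u\<in>W. \<exists>v\<in>W. \<phi> x0 / n \<le> \<bar>wedge (word_mat E u *v x) (word_mat E v *v x)\<bar>"
      proof (rule ccontr)
        assume "\<not> ?thesis"
        then have "\<phi> x < of_nat (card (W \<times> W)) * (\<phi> x0 / n)"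
          unfolding \<phi>_def[of x] using n finW by (intro sum_bounded_above_strict) (auto simp: n_def not_le)
        also have "\<dots> = \<phi> x0" using n by (simp add: n_def[symmetric])
        finally show False using x0(2)[OF x] by simp
      qed
    qed
    then show ?thesis by blast
  qed
  then obtain f where f: "\<And>W. W \<in> Q \<Longrightarrow> P W (f W)" by metis
  \<comment> \<open>The inserted 1 keeps the minimum meaningful if \<open>Q\<close> is
    empty.\<close>
  define \<delta> where "\<delta> = Min (insert 1 (f ` Q))"
  have \<delta>: "\<delta> \<le> f W" if "W \<in> Q" for W
    unfolding \<delta>_def using that finQ by (intro Min_le) auto
  have "\<delta> \<in> insert 1 (f ` Q)" unfolding \<delta>_def using finQ by (intro Min_in) auto
  then have "\<delta> > 0" using f by (auto simp: P_def)
  then show thesis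
  proof (rule that[of \<delta> k])
    fix x W assume "norm (x :: real^2) = 1" "W \<subseteq> words k" "\<eta> < avg k (\<lambda>w. of_bool (w \<in> W))"
    then show "\<exists>u\<in>W. \<exists>v\<in>W. \<delta> \<le> \<bar>wedge (word_mat E u *v x) (word_mat E v *v x)\<bar>"
      using f[of W] \<delta>[of W] unfolding P_def Q_def by (fastforce intro: order_trans)
  qed
qed

definition mean_log_at :: "nat \<Rightarrow> real \<Rightarrow> real^2 \<Rightarrow> real" where
  "mean_log_at n E x = avg n (\<lambda>w. ln (norm (word_mat E w *v x)))"

lemma norm_word_pos: "w \<in> words n \<Longrightarrow> x \<noteq> 0 \<Longrightarrow> norm (word_mat E w *v x) > 0"
  using matrix_vector_nonzero[OF det_word] by simp

lemma mean_log_at_le: "norm x = 1 \<Longrightarrow> mean_log_at n E x \<le> mean_log n E"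
  unfolding mean_log_at_def mean_log_def
proof (rule avg_mono)
  fix w assume x: "norm x = 1" and w: "w \<in> words n"
  have "norm (word_mat E w *v x) \<le> opnorm (word_mat E w)"
    using norm_le_opnorm[of "word_mat E w" x] x by simp
  moreover have "x \<noteq> 0" using x by auto
  ultimately show "ln (norm (word_mat E w *v x)) \<le> ln (opnorm (word_mat E w))"
    using norm_word_pos[OF w] by (intro ln_mono)
qed

text \<open>A word of length \<open>n\<close> expands \<open>x\<close> much less than its last \<open>n - k\<close> letters can only if its
  first \<open>k\<close> letters bring \<open>x\<close> close to one particular direction, which has small probability.\<close>

lemma mean_log_at_ge:
  fixes \<eta> :: real
  assumes E: "E \<noteq> 0" and \<eta>: "\<eta> > 0"
  obtains k K where "\<And>n x. k \<le> n \<Longrightarrow> norm x = 1 \<Longrightarrow> mean_log n E - K - \<eta> * n \<le> mean_log_at n E x"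
proof -
  obtain C where C: "C > 1" "\<And>a. a \<in> set_pmf p \<Longrightarrow> opnorm (one_step E a) \<le> C"
    using one_step_bound by blast
  have lnC: "ln C > 0" using C by simp
  \<comment> \<open>Each bad pair of words is charged 2 * n * ln C below; this choice makes the
    total charge \<eta> * n.\<close>
  define \<eta>' where "\<eta>' = \<eta> / (2 * ln C)"
  have \<eta>': "\<eta>' > 0" using \<eta> lnC by (simp add: \<eta>'_def)
  obtain k \<delta> where \<delta>: "\<delta> > 0" and sep:
    "\<And>x W. norm x = 1 \<Longrightarrow> W \<subseteq> words k \<Longrightarrow> \<eta>' < avg k (\<lambda>w. of_bool (w \<in> W)) \<Longrightarrow>
       \<exists>u\<in>W. \<exists>v\<in>W. \<delta> \<le> \<bar>wedge (word_mat E u *v x) (word_mat E v *v x)\<bar>"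
    using separated_images[OF E \<eta>'] by metis
  define c where "c = C ^ k"
  have c: "c > 0" using C by (simp add: c_def)
  \<comment> \<open>Two bad words with separated images would give \<delta> < 2 * c * \<theta> by
    \<open>wedge_opnorm_le\<close>. The bound by 1 makes \<open>ln \<theta>\<close>
    nonpositive.\<close>
  define \<theta> where "\<theta> = min 1 (\<delta> / (2 * c))"
  have \<theta>: "0 < \<theta>" "\<theta> \<le> 1" "2 * c * \<theta> \<le> \<delta>" using \<delta> c by (auto simp: \<theta>_def min_def field_simps)
  show thesis
  proof (rule that[of k "mean_log k E - ln \<theta>"])
    fix n and x :: "real^2" assume n: "k \<le> n" and x: "norm x = 1"
    have x0: "x \<noteq> 0" using x by auto
    define m where "m = n - k"
    have nm: "n = k + m" using n by (simp add: m_def)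
    let ?X = "\<lambda>w v. norm (word_mat E v *v (word_mat E w *v x))"
    let ?W = "\<lambda>v. {w \<in> words k. ?X w v < \<theta> * opnorm (word_mat E v)}"
    have bad: "avg k (\<lambda>w. of_bool (w \<in> ?W v)) \<le> \<eta>'" if v: "v \<in> words m" for v
    proof (rule ccontr)
      assume "\<not> ?thesis"
      then obtain w w' where w: "w \<in> ?W v" "w' \<in> ?W v"
        and s: "\<delta> \<le> \<bar>wedge (word_mat E w *v x) (word_mat E w' *v x)\<bar>"
        using sep[OF x, of "?W v"] by (force simp: not_le)
      have le: "norm (word_mat E u *v x) \<le> c" if "u \<in> words k" for u
        using norm_le_opnorm[of "word_mat E u" x] opnorm_word_le[OF C(2) that] x by (simp add: c_def)
      have op: "opnorm (word_mat E v) > 0" using opnorm_word_ge_1[OF v, of E] by simp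
      have "\<delta> * opnorm (word_mat E v) \<le> \<bar>wedge (word_mat E w *v x) (word_mat E w' *v x)\<bar> * opnorm (word_mat E v)"
        using s op by simp
      also have "\<dots> \<le> c * (?X w v + ?X w' v)"
        by (rule wedge_opnorm_le) (use le w in auto)
      also have "\<dots> < c * (\<theta> * opnorm (word_mat E v) + \<theta> * opnorm (word_mat E v))"
        using w c by (intro mult_strict_left_mono add_strict_mono) auto
      also have "\<dots> = (2 * c * \<theta>) * opnorm (word_mat E v)" by simp
      also have "\<dots> \<le> \<delta> * opnorm (word_mat E v)" using \<theta>(3) op by simp
      finally show False by simp
    qed
    \<comment> \<open>For bad words only trivial bounds are used: the image of x has logarithmic
      norm at least - n * ln C, and \<open>v\<close> has logarithmic norm at most n * ln C.\<close>
    have pt: "ln \<theta> + ln (opnorm (word_mat E v)) - (2 * n * ln C) * of_bool (w \<in> ?W v) \<le> ln (?X w v)"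
      if w: "w \<in> words k" and v: "v \<in> words m" for w v
    proof -
      have op: "opnorm (word_mat E v) \<ge> 1" using opnorm_word_ge_1[OF v] .
      have wv: "w @ v \<in> words n" using append_in_words[OF w v] by (simp add: nm)
      have X: "?X w v > 0" using norm_word_pos[OF wv x0, of E] by (simp add: word_mat_append_apply)
      show ?thesis
      proof (cases "w \<in> ?W v")
        case False
        then have "\<theta> * opnorm (word_mat E v) \<le> ?X w v" using w by auto
        then have "ln (\<theta> * opnorm (word_mat E v)) \<le> ln (?X w v)" using X \<theta>(1) op
          by (subst ln_le_cancel_iff) auto
        moreover have "ln (\<theta> * opnorm (word_mat E v)) = ln \<theta> + ln (opnorm (word_mat E v))"
          using \<theta>(1) op by (intro ln_mult_pos) auto
        moreover have "of_bool (w \<in> ?W v) = (0 :: real)" using False by simp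
        ultimately show ?thesis by (simp only: mult_zero_right diff_zero)
      next
        case True
        have "1 \<le> opnorm (word_mat E (w @ v)) * ?X w v"
          using norm_le_opnorm_mult[OF det_word[OF wv], of x E] x by (simp add: word_mat_append_apply)
        also have "\<dots> \<le> C ^ n * ?X w v"
          by (intro mult_right_mono opnorm_word_le[OF C(2) wv]) auto
        finally have "ln 1 \<le> ln (C ^ n * ?X w v)" using X C(1) by (subst ln_le_cancel_iff) auto
        then have 1: "- (n * ln C) \<le> ln (?X w v)" using X C(1) by (simp add: ln_mult ln_realpow)
        have "opnorm (word_mat E v) \<le> C ^ m" by (rule opnorm_word_le[OF C(2) v])
        also have "\<dots> \<le> C ^ n" using C(1) by (intro power_increasing) (auto simp: nm)
        finally have "ln (opnorm (word_mat E v)) \<le> ln (C ^ n)" using op C(1) by (subst ln_le_cancel_iff) auto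
        then have "ln (opnorm (word_mat E v)) \<le> n * ln C" using C(1) by (simp add: ln_realpow)
        moreover have "ln \<theta> \<le> 0" using \<theta> by simp
        ultimately show ?thesis using True 1 by simp
      qed
    qed
    have e: "(2 * n * ln C) * \<eta>' = \<eta> * n" using lnC by (simp add: \<eta>'_def)
    have "mean_log n E - (mean_log k E - ln \<theta>) - \<eta> * n \<le> ln \<theta> + mean_log m E - (2 * n * ln C) * \<eta>'"
      using mean_log_subadd[of k m E] unfolding e by (simp add: nm)
    also have "\<dots> = avg m (\<lambda>v. ln \<theta> + ln (opnorm (word_mat E v)) - (2 * n * ln C) * \<eta>')"
      unfolding avg_diff avg_add avg_const mean_log_def ..
    also have "\<dots> \<le> avg m (\<lambda>v. ln \<theta> + ln (opnorm (word_mat E v)) - (2 * n * ln C) * avg k (\<lambda>w. of_bool (w \<in> ?W v)))"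
      using bad lnC by (intro avg_mono diff_left_mono mult_left_mono) auto
    also have "\<dots> = avg m (\<lambda>v. avg k (\<lambda>w. ln \<theta> + ln (opnorm (word_mat E v)) - (2 * n * ln C) * of_bool (w \<in> ?W v)))"
      unfolding avg_diff avg_add avg_const avg_cmult ..
    also have "\<dots> \<le> avg m (\<lambda>v. avg k (\<lambda>w. ln (?X w v)))"
      by (intro avg_mono pt)
    also have "\<dots> = mean_log_at n E x"
      unfolding mean_log_at_def nm avg_append word_mat_append_apply by (rule avg_swap)
    finally show "mean_log n E - (mean_log k E - ln \<theta>) - \<eta> * n \<le> mean_log_at n E x" .
  qed
qed

text \<open>After \<open>j\<close> blocks the vector reached is renormalised; the next block adds at
  least \<open>c\<close> on average whatever its direction, which is why bounds uniform in x are
  sought.\<close>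

lemma mean_log_at_superadd:
  assumes c: "\<And>x. norm x = 1 \<Longrightarrow> c \<le> mean_log_at n E x" and x: "norm x = 1"
  shows "real j * c \<le> mean_log_at (j * n) E x"
proof (induction j)
  case 0
  show ?case by (simp add: mean_log_at_def x)
next
  case (Suc j)
  have x0: "x \<noteq> 0" using x by auto
  have "real j * c + c \<le> mean_log_at (j * n) E x + avg (j * n) (\<lambda>w. mean_log_at n E (sgn (word_mat E w *v x)))"
    using x0 by (intro add_mono Suc avg_ge_const c)
      (auto simp: norm_sgn dest: norm_word_pos)
  also have "\<dots> = avg (j * n) (\<lambda>w. ln (norm (word_mat E w *v x)) + mean_log_at n E (sgn (word_mat E w *v x)))"
    by (simp add: avg_add mean_log_at_def[of "j * n"])
  also have "\<dots> = mean_log_at (j * n + n) E x"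
    unfolding mean_log_at_def[of "j * n + n"] avg_append
  proof (rule avg_cong)
    fix w assume w: "w \<in> words (j * n)"
    define y where "y = word_mat E w *v x"
    have y: "norm y > 0" unfolding y_def by (rule norm_word_pos[OF w x0])
    have "mean_log_at n E (sgn y) = avg n (\<lambda>v. ln (norm (word_mat E v *v y)) - ln (norm y))"
      unfolding mean_log_at_def
    proof (rule avg_cong)
      fix v assume v: "v \<in> words n"
      have "word_mat E v *v sgn y = (1 / norm y) *\<^sub>R (word_mat E v *v y)"
        by (simp add: sgn_div_norm matrix_vector_mult_scaleR inverse_eq_divide)
      then show "ln (norm (word_mat E v *v sgn y)) = ln (norm (word_mat E v *v y)) - ln (norm y)"
        using norm_word_pos[OF v, of y E] y by (simp add: ln_div)
    qed
    then show "ln (norm (word_mat E w *v x)) + mean_log_at n E (sgn (word_mat E w *v x))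
        = avg n (\<lambda>v. ln (norm (word_mat E (w @ v) *v x)))"
      unfolding y_def[symmetric] word_mat_append_apply by (simp add: avg_diff)
  qed
  finally show ?case by (simp add: algebra_simps)
qed

text \<open>Length 0 is excluded: division by zero would yield the value 0 there and make the
  infimum vanish.\<close>

definition lyap :: "real \<Rightarrow> real" where
  "lyap E = (INF n\<in>{1..}. mean_log n E / n)"

lemma lyap_tendsto: "(\<lambda>n. mean_log n E / n) \<longlonglongrightarrow> lyap E"
  unfolding lyap_def by (rule mean_log_tendsto)

lemma bdd_below_mean_log: "bdd_below ((\<lambda>n. mean_log n E / real n) ` {1..})"
  by (rule bdd_belowI[of _ 0]) (auto simp: mean_log_nonneg)

lemma lyap_le: "n \<ge> 1 \<Longrightarrow> lyap E \<le> mean_log n E / n"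
  unfolding lyap_def by (rule cINF_lower[OF bdd_below_mean_log]) auto

lemma lyap_nonneg: "0 \<le> lyap E"
  unfolding lyap_def by (rule cINF_greatest) (auto simp: mean_log_nonneg)

lemma lyap_ge_subseq:
  assumes n: "n \<ge> 1" and le: "\<And>j. real j * c \<le> mean_log (j * n) E"
  shows "c / n \<le> lyap E"
proof (rule tendsto_lowerbound)
  have "strict_mono (\<lambda>j. j * n)" using n by (intro strict_monoI) simp
  from LIMSEQ_subseq_LIMSEQ[OF lyap_tendsto this]
  show "(\<lambda>j. mean_log (j * n) E / real (j * n)) \<longlonglongrightarrow> lyap E" by (simp add: o_def)
  show "\<forall>\<^sub>F j in sequentially. c / n \<le> mean_log (j * n) E / real (j * n)"
    using eventually_gt_at_top[of 0]
  proof eventually_elim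
    case (elim j)
    have "c / n = real j * c / real (j * n)" using elim by simp
    also have "\<dots> \<le> mean_log (j * n) E / real (j * n)" by (intro divide_right_mono le) simp
    finally show ?case .
  qed
qed simp

lemma lyap_ge:
  assumes "n \<ge> 1" "\<And>x. norm x = 1 \<Longrightarrow> c \<le> mean_log_at n E x"
  shows "c / n \<le> lyap E"
proof (rule lyap_ge_subseq[OF assms(1)])
  fix j
  have x: "norm (axis 1 1 :: real^2) = 1" by (simp add: norm_axis_1)
  show "real j * c \<le> mean_log (j * n) E"
    using mean_log_at_superadd[OF assms(2) x] mean_log_at_le[OF x] order_trans by blast
qed

lemma lyap_pos:
  assumes "E \<noteq> 0" shows "lyap E > 0"
proof -
  obtain c where c: "c > 0" "\<And>n. c * n \<le> mean_log (3 * n) E"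
    using mean_log_linear[OF assms] by blast
  have "c / real 3 \<le> lyap E"
    by (rule lyap_ge_subseq) (use c(2) in \<open>auto simp: mult.commute\<close>)
  then show ?thesis using c(1) by simp
qed

section \<open>Dependence on the energy\<close>

lemma word_mat_nth_tendsto: "((\<lambda>E. word_mat E w $ i $ j) \<longlongrightarrow> word_mat E0 w $ i $ j) (at E0)"
proof (induction w arbitrary: i j)
  case (Cons a w)
  have one: "((\<lambda>E. one_step E a $ i $ j) \<longlongrightarrow> one_step E0 a $ i $ j) (at E0)" for i j
  proof -
    have "(\<lambda>E. one_step E a $ 1 $ 1) \<midarrow>E0\<rightarrow> one_step E0 a $ 1 $ 1"
      unfolding one_step_nth divide_inverse by (intro tendsto_intros)
    then show ?thesis using exhaust_2[of i] exhaust_2[of j] by auto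
  qed
  then show ?case
    unfolding word_mat.simps matrix_matrix_2 by (intro tendsto_add tendsto_mult Cons one)
qed simp

lemma word_mat_diff_tendsto: "((\<lambda>E. opnorm (word_mat E w - word_mat E0 w)) \<longlongrightarrow> 0) (at E0)"
proof (rule tendsto_sandwich)
  show "\<forall>\<^sub>F E in at E0. 0 \<le> opnorm (word_mat E w - word_mat E0 w)" by (simp add: opnorm_nonneg)
  show "\<forall>\<^sub>F E in at E0. opnorm (word_mat E w - word_mat E0 w) \<le>
      \<bar>word_mat E w $ 1 $ 1 - word_mat E0 w $ 1 $ 1\<bar> + \<bar>word_mat E w $ 1 $ 2 - word_mat E0 w $ 1 $ 2\<bar>
      + \<bar>word_mat E w $ 2 $ 1 - word_mat E0 w $ 2 $ 1\<bar> + \<bar>word_mat E w $ 2 $ 2 - word_mat E0 w $ 2 $ 2\<bar>"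
    using opnorm_le_sum_abs[of "word_mat _ w - word_mat E0 w"] by (intro always_eventually allI) simp
  show "((\<lambda>E. \<bar>word_mat E w $ 1 $ 1 - word_mat E0 w $ 1 $ 1\<bar> + \<bar>word_mat E w $ 1 $ 2 - word_mat E0 w $ 1 $ 2\<bar>
      + \<bar>word_mat E w $ 2 $ 1 - word_mat E0 w $ 2 $ 1\<bar> + \<bar>word_mat E w $ 2 $ 2 - word_mat E0 w $ 2 $ 2\<bar>)
      \<longlongrightarrow> 0) (at E0)"
    by (intro tendsto_add_zero tendsto_rabs_zero LIM_zero word_mat_nth_tendsto)
qed simp

lemma opnorm_word_tendsto: "((\<lambda>E. opnorm (word_mat E w)) \<longlongrightarrow> opnorm (word_mat E0 w)) (at E0)"
  by (rule LIM_zero_cancel, rule tendsto_rabs_zero_cancel,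
      rule tendsto_sandwich[OF _ _ tendsto_const word_mat_diff_tendsto])
    (auto intro!: always_eventually opnorm_diff_le)

lemma mean_log_tendsto_at: "((\<lambda>E. mean_log n E) \<longlongrightarrow> mean_log n E0) (at E0)"
  unfolding mean_log_def avg_def
proof (intro tendsto_sum tendsto_mult tendsto_const tendsto_ln opnorm_word_tendsto)
  show "w \<in> words n \<Longrightarrow> opnorm (word_mat E0 w) \<noteq> 0" for w
    using opnorm_word_ge_1[of w n E0] by auto
qed

text \<open>Determinant one bounds the norm of x by that of its image, so a perturbation of the
  matrix changes the image by a relative error independent of x; \<open>r\<close> is the resulting
  factor.\<close>

lemma eventually_mean_log_at_ge:
  assumes "\<epsilon> > 0"
  shows "\<forall>\<^sub>F E in at E0. \<forall>x. norm x = 1 \<longrightarrow> mean_log_at n E0 x - \<epsilon> \<le> mean_log_at n E x"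
proof -
  define r where "r E w = 1 - opnorm (word_mat E w - word_mat E0 w) * opnorm (word_mat E0 w)" for E w
  have r: "((\<lambda>E. r E w) \<longlongrightarrow> 1) (at E0)" for w
    unfolding r_def by (rule tendsto_eq_intros word_mat_diff_tendsto refl | simp)+
  have "((\<lambda>E. ln (r E w)) \<longlongrightarrow> 0) (at E0)" for w
    using tendsto_ln[OF r] by simp
  then have "\<forall>\<^sub>F E in at E0. - \<epsilon> < ln (r E w)" for w
    by (rule order_tendstoD(1)) (use assms in simp)
  moreover have "\<forall>\<^sub>F E in at E0. 0 < r E w" for w
    by (rule order_tendstoD(1)[OF r]) simp
  ultimately have "\<forall>\<^sub>F E in at E0. 0 < r E w \<and> - \<epsilon> < ln (r E w)" for w
    by (simp add: eventually_conj)
  then have "\<forall>\<^sub>F E in at E0. \<forall>w\<in>words n. 0 < r E w \<and> - \<epsilon> < ln (r E w)"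
    by (intro eventually_ball_finite) auto
  then show ?thesis
  proof eventually_elim
    case (elim E)
    show ?case
    proof (intro allI impI)
      fix x :: "real^2" assume x: "norm x = 1"
      then have x0: "x \<noteq> 0" by auto
      have "mean_log_at n E0 x - \<epsilon> = avg n (\<lambda>w. ln (norm (word_mat E0 w *v x)) - \<epsilon>)"
        by (simp add: avg_diff mean_log_at_def)
      also have "\<dots> \<le> mean_log_at n E x"
        unfolding mean_log_at_def
      proof (rule avg_mono)
        fix w assume w: "w \<in> words n"
        let ?\<Delta> = "opnorm (word_mat E w - word_mat E0 w)"
        have "norm (word_mat E0 w *v x) * r E w
           = norm (word_mat E0 w *v x) - ?\<Delta> * (opnorm (word_mat E0 w) * norm (word_mat E0 w *v x))"
          by (simp add: r_def algebra_simps)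
        also have "\<dots> \<le> norm (word_mat E0 w *v x) - ?\<Delta> * norm x"
          by (intro diff_left_mono mult_left_mono norm_le_opnorm_mult opnorm_nonneg det_word[OF w])
        also have "\<dots> \<le> norm (word_mat E0 w *v x) - norm ((word_mat E w - word_mat E0 w) *v x)"
          by (intro diff_left_mono norm_le_opnorm)
        also have "\<dots> \<le> norm (word_mat E w *v x)"
          using norm_triangle_ineq2[of "word_mat E0 w *v x" "word_mat E0 w *v x - word_mat E w *v x"]
          by (simp add: matrix_vector_mult_diff_rdistrib norm_minus_commute)
        finally have "ln (norm (word_mat E0 w *v x) * r E w) \<le> ln (norm (word_mat E w *v x))"
          using elim w norm_word_pos[OF w x0] by (subst ln_le_cancel_iff) auto
        then have "ln (norm (word_mat E0 w *v x)) + ln (r E w) \<le> ln (norm (word_mat E w *v x))"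
          using elim w norm_word_pos[OF w x0, of E0] by (subst (asm) ln_mult) auto
        then show "ln (norm (word_mat E0 w *v x)) - \<epsilon> \<le> ln (norm (word_mat E w *v x))"
          using elim w by force
      qed
      finally show "mean_log_at n E0 x - \<epsilon> \<le> mean_log_at n E x" .
    qed
  qed
qed

lemma lyap_upper_semicont:
  assumes "lyap E0 < y" shows "\<forall>\<^sub>F E in at E0. lyap E < y"
proof -
  obtain n where n: "n \<ge> 1" "mean_log n E0 / n < y"
    using assms unfolding lyap_def by (subst (asm) cINF_less_iff[OF _ bdd_below_mean_log]) auto
  have "((\<lambda>E. mean_log n E / n) \<longlongrightarrow> mean_log n E0 / n) (at E0)"
    using n by (intro tendsto_intros mean_log_tendsto_at) auto
  from order_tendstoD(2)[OF this n(2)] show ?thesis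
    by eventually_elim (use lyap_le[OF n(1)] in \<open>auto intro: le_less_trans\<close>)
qed

lemma lyap_lower_semicont:
  assumes E0: "E0 \<noteq> 0" and y: "y < lyap E0" shows "\<forall>\<^sub>F E in at E0. y < lyap E"
proof -
  \<comment> \<open>Of the four quarters, one absorbs \<open>K\<close>, one the linear error of
    \<open>mean_log_at_ge\<close>, one the change of energy, and one keeps the inequality
    strict.\<close>
  define \<epsilon> where "\<epsilon> = (lyap E0 - y) / 4"
  have \<epsilon>: "\<epsilon> > 0" using y by (simp add: \<epsilon>_def)
  obtain k K where k: "\<And>n x. k \<le> n \<Longrightarrow> norm x = 1 \<Longrightarrow> mean_log n E0 - K - \<epsilon> * n \<le> mean_log_at n E0 x"
    using mean_log_at_ge[OF E0 \<epsilon>] by metis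
  obtain n0 :: nat where n0: "K / \<epsilon> < n0" using reals_Archimedean2 by blast
  define n where "n = max (max k 1) n0"
  have n: "n \<ge> 1" "n \<ge> k" "n \<ge> n0" by (auto simp: n_def)
  have "K / \<epsilon> < n" using n0 n(3) by linarith
  then have K: "K \<le> \<epsilon> * n" using \<epsilon> by (simp add: field_simps)
  have at0: "n * (y + 2 * \<epsilon>) \<le> mean_log_at n E0 x" if "norm x = 1" for x
  proof -
    have "n * lyap E0 \<le> mean_log n E0" using lyap_le[OF n(1), of E0] n(1) by (simp add: field_simps)
    moreover have "n * lyap E0 = n * y + 4 * (\<epsilon> * n)" by (simp add: \<epsilon>_def field_simps)
    ultimately show ?thesis using k[OF n(2) that] K by (simp add: algebra_simps)
  qed
  have "\<epsilon> * n > 0" using \<epsilon> n by simp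
  from eventually_mean_log_at_ge[OF this, of n E0] show ?thesis
  proof eventually_elim
    case (elim E)
    have "n * (y + \<epsilon>) \<le> mean_log_at n E x" if "norm x = 1" for x
      using elim at0[OF that] that by (force simp: algebra_simps)
    then have "n * (y + \<epsilon>) / n \<le> lyap E" by (rule lyap_ge[OF n(1)])
    then show ?case using n \<epsilon> by simp
  qed
qed

end

subsection \<open>Vanishing energy and the shift space\<close>

text \<open>At energy zero a pair of letters acts as minus a diagonal matrix with entries sqrt (a /
  b) and sqrt (b / a). This sums the logarithms of the first entries; a trailing single letter
  counts as 0, and only even lengths are used.\<close>

fun alt_sum :: "nat list \<Rightarrow> real" where
  "alt_sum (a # b # w) = alt_sum w + (ln a - ln b) / 2"
| "alt_sum _ = 0"

lemma opnorm_word_mat_0: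
  assumes "\<And>a. a \<in> set w \<Longrightarrow> a > 0" "even (length w)"
  shows "opnorm (word_mat 0 w) = exp \<bar>alt_sum w\<bar>"
proof -
  have "\<exists>s\<in>{1, - 1}. word_mat 0 w = diag2 (s * exp (alt_sum w)) (s * exp (- alt_sum w))"
    using assms
  proof (induction w rule: alt_sum.induct)
    case (1 a b w)
    from "1.prems" have pos: "a > 0" "b > 0" by auto
    have "\<exists>s\<in>{1, - 1}. word_mat 0 w = diag2 (s * exp (alt_sum w)) (s * exp (- alt_sum w))"
      by (rule "1.IH") (use "1.prems" in auto)
    then obtain s where s: "s \<in> {1, - 1}" "word_mat 0 w = diag2 (s * exp (alt_sum w)) (s * exp (- alt_sum w))"
      by blast
    define g where "g = (ln (real a) - ln (real b)) / 2"
    have "exp g = sqrt a / sqrt b" "exp (- g) = sqrt b / sqrt a"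
      using pos by (simp_all add: g_def exp_diff exp_minus ln_sqrt[symmetric] diff_divide_distrib)
    moreover have "one_step 0 b ** one_step 0 a = diag2 (- (sqrt a / sqrt b)) (- (sqrt b / sqrt a))"
      by (simp add: vec2_eq_iff matrix_matrix_2)
    ultimately have "one_step 0 b ** one_step 0 a = diag2 (- exp g) (- exp (- g))" by simp
    then have "word_mat 0 (a # b # w) = diag2 (s * exp (alt_sum w)) (s * exp (- alt_sum w)) ** diag2 (- exp g) (- exp (- g))"
      by (simp add: s(2) matrix_mul_assoc[symmetric])
    also have "\<dots> = diag2 ((- s) * exp (alt_sum w + g)) ((- s) * exp (- (alt_sum w + g)))"
      by (simp add: diag2_mult exp_add[symmetric] mult.assoc)
    finally have "word_mat 0 (a # b # w) = diag2 ((- s) * exp (alt_sum w + g)) ((- s) * exp (- (alt_sum w + g)))" .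
    then show ?case using s(1) by (intro bexI[of _ "- s"]) (auto simp: g_def)
  qed (auto simp: mat_def vec2_eq_iff)
  then have "opnorm (word_mat 0 w) = max (exp (alt_sum w)) (exp (- alt_sum w))"
    by (auto simp: opnorm_diag2 abs_mult)
  then show ?thesis by (auto simp: max_def abs_if)
qed

lemma shift_pow: "(shift ^^ n) \<omega> k = \<omega> (k + n)"
  by (induction n arbitrary: k) (simp_all add: shift_def)

context letters begin

text \<open>The increments are independent, and centred because both letters of a pair have the same
  law; the cross terms vanish.\<close>

lemma alt_sum_second_moment:
  "avg (2 * n) (\<lambda>w. (alt_sum w)\<^sup>2) = n * avg 2 (\<lambda>w. (alt_sum w)\<^sup>2)"
proof (induction n)
  case (Suc n)
  have add: "alt_sum (u @ w) = alt_sum u + alt_sum w" if "u \<in> words 2" for u w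
    using that by (auto simp: words_def length_Suc_conv numeral_eq_Suc)
  have p1: "(\<Sum>a\<in>set_pmf p. pmf p a) = 1" by (rule sum_pmf_eq_1) auto
  have "avg 2 alt_sum = (\<Sum>a\<in>set_pmf p. pmf p a * (\<Sum>b\<in>set_pmf p. pmf p b * ((ln a - ln b) / 2)))"
    by (simp add: numeral_2_eq_2 avg_Suc)
  also have "\<dots> = (\<Sum>a\<in>set_pmf p. pmf p a * (ln a / 2 - (\<Sum>b\<in>set_pmf p. pmf p b * ln b / 2)))"
  proof (rule sum.cong[OF refl])
    fix a :: nat
    have "(\<Sum>b\<in>set_pmf p. pmf p b * ((ln a - ln b) / 2)) =
      (\<Sum>b\<in>set_pmf p. pmf p b) * (ln a / 2) - (\<Sum>b\<in>set_pmf p. pmf p b * ln b / 2)"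
      by (simp add: sum_distrib_right sum_subtractf sum_divide_distrib right_diff_distrib diff_divide_distrib)
    then show "pmf p a * (\<Sum>b\<in>set_pmf p. pmf p b * ((ln a - ln b) / 2)) =
       pmf p a * (ln a / 2 - (\<Sum>b\<in>set_pmf p. pmf p b * ln b / 2))" by (simp add: p1)
  qed
  also have "\<dots> = (\<Sum>a\<in>set_pmf p. pmf p a * ln a / 2) - (\<Sum>a\<in>set_pmf p. pmf p a) * (\<Sum>b\<in>set_pmf p. pmf p b * ln b / 2)"
    by (simp add: right_diff_distrib sum_subtractf sum_distrib_right)
  finally have mean: "avg 2 alt_sum = 0" by (simp add: p1)
  have "avg (2 * Suc n) (\<lambda>w. (alt_sum w)\<^sup>2) = avg 2 (\<lambda>u. avg (2 * n) (\<lambda>w. (alt_sum (u @ w))\<^sup>2))"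
    using avg_append[of 2 "2 * n"] by simp
  also have "\<dots> = avg 2 (\<lambda>u. avg (2 * n) (\<lambda>w. (alt_sum w)\<^sup>2 + ((2 * alt_sum u) * alt_sum w + (alt_sum u)\<^sup>2)))"
    by (intro avg_cong) (simp add: add power2_eq_square algebra_simps)
  also have "\<dots> = avg 2 (\<lambda>u. avg (2 * n) (\<lambda>w. (alt_sum w)\<^sup>2) + ((2 * avg (2 * n) alt_sum) * alt_sum u + (alt_sum u)\<^sup>2))"
    by (intro avg_cong) (simp only: avg_add avg_cmult avg_const, simp add: ac_simps)
  also have "\<dots> = n * avg 2 (\<lambda>w. (alt_sum w)\<^sup>2) + avg 2 (\<lambda>u. (alt_sum u)\<^sup>2)"
    unfolding avg_add avg_cmult mean avg_const Suc by simp
  finally show ?case by (simp add: algebra_simps)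
qed simp

text \<open>In place of Cauchy-Schwarz, \<bar>X\<bar> <= X ^ 2 / (2 * r) + r / 2 is averaged; r =
  sqrt n balances the linear second moment.\<close>

lemma mean_log_0_le:
  assumes n: "n > 0"
  shows "mean_log (2 * n) 0 \<le> sqrt n * ((avg 2 (\<lambda>w. (alt_sum w)\<^sup>2) + 1) / 2)"
proof -
  define r where "r = sqrt n"
  have r: "r > 0" "r * r = n" using n by (auto simp: r_def)
  have "mean_log (2 * n) 0 \<le> avg (2 * n) (\<lambda>w. (1 / (2 * r)) * (alt_sum w)\<^sup>2 + r / 2)"
    unfolding mean_log_def
  proof (rule avg_mono)
    fix w assume w: "w \<in> words (2 * n)"
    then have "ln (opnorm (word_mat 0 w)) = \<bar>alt_sum w\<bar>"
      by (subst opnorm_word_mat_0) (auto simp: words_def letter_pos)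
    moreover have "2 * r * \<bar>alt_sum w\<bar> \<le> (alt_sum w)\<^sup>2 + r * r"
      using zero_le_power2[of "\<bar>alt_sum w\<bar> - r"] by (simp add: power2_eq_square algebra_simps)
    ultimately show "ln (opnorm (word_mat 0 w)) \<le> (1 / (2 * r)) * (alt_sum w)\<^sup>2 + r / 2"
      using r(1) by (simp add: field_simps)
  qed
  also have "\<dots> = (1 / (2 * r)) * (n * avg 2 (\<lambda>w. (alt_sum w)\<^sup>2)) + r / 2"
    by (simp only: avg_add avg_cmult avg_const alt_sum_second_moment)
  also have "\<dots> = r * ((avg 2 (\<lambda>w. (alt_sum w)\<^sup>2) + 1) / 2)"
    using r(1) by (simp add: r(2)[symmetric] field_simps)
  finally show ?thesis by (simp add: r_def)
qed

lemma lyap_0: "lyap 0 = 0"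
proof (rule ccontr)
  define c where "c = (avg 2 (\<lambda>w. (alt_sum w)\<^sup>2) + 1) / 2"
  assume "lyap 0 \<noteq> 0"
  then have pos: "lyap 0 > 0" using lyap_nonneg[of 0] by simp
  obtain m :: nat where m: "(c / lyap 0)\<^sup>2 < m" using reals_Archimedean2 by blast
  define n where "n = max m 1"
  have n: "n \<ge> 1" "(c / lyap 0)\<^sup>2 < n" using m by (auto simp: n_def)
  have "lyap 0 \<le> mean_log (2 * n) 0 / real (2 * n)" by (rule lyap_le) (use n in simp)
  also have "\<dots> \<le> (sqrt n * c) / real (2 * n)"
    using mean_log_0_le[of n] n(1) by (intro divide_right_mono) (simp_all add: c_def)
  finally have "lyap 0 * (2 * (sqrt n * sqrt n)) \<le> sqrt n * c" using n by (simp add: field_simps)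
  then have "sqrt n * (lyap 0 * (2 * sqrt n)) \<le> sqrt n * c" by (simp only: ac_simps)
  then have "lyap 0 * (2 * sqrt n) \<le> c" using n(1) by simp
  moreover have "lyap 0 * sqrt n \<ge> 0" using pos by simp
  ultimately have "lyap 0 * sqrt n \<le> c" by linarith
  then have "sqrt n \<le> c / lyap 0" using pos by (simp add: field_simps)
  then have "(sqrt n)\<^sup>2 \<le> (c / lyap 0)\<^sup>2" by (intro power_mono) auto
  then show False using n by simp
qed

lemma isCont_lyap: "isCont lyap E0"
  unfolding isCont_def
proof (rule order_tendstoI)
  fix y assume "y < lyap E0"
  then show "\<forall>\<^sub>F E in at E0. y < lyap E"
    using lyap_lower_semicont[of E0 y] lyap_0
    by (cases "E0 = 0") (auto intro!: always_eventually less_le_trans[OF _ lyap_nonneg])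
qed (rule lyap_upper_semicont)

section \<open>From the product measure to finite words\<close>

definition letter_space :: "nat measure" where
  "letter_space = restrict_space (measure_pmf p) (set_pmf p)"

lemma mu_eq: "mu p = PiM UNIV (\<lambda>_. letter_space)"
  by (simp add: mu_def letter_space_def)

lemma prob_space_letter: "prob_space letter_space"
  unfolding letter_space_def
  by (intro prob_spaceI)
    (simp add: space_restrict_space emeasure_restrict_space emeasure_pmf)

lemma space_letter: "space letter_space = set_pmf p"
  by (simp add: letter_space_def space_restrict_space)

lemma measurable_coordinate: "(\<lambda>\<omega>. \<omega> i) \<in> mu p \<rightarrow>\<^sub>M count_space UNIV"
proof -
  have "(\<lambda>\<omega>. \<omega> i) \<in> mu p \<rightarrow>\<^sub>M letter_space"
    unfolding mu_eq by (rule measurable_component_singleton) simp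
  moreover have "(\<lambda>x. x) \<in> letter_space \<rightarrow>\<^sub>M count_space UNIV"
    unfolding letter_space_def by (intro measurable_restrict_space1) simp
  ultimately show ?thesis by (rule measurable_compose)
qed

lemma measurable_prefix: "(\<lambda>\<omega>. F (map \<omega> [0..<n])) \<in> borel_measurable (mu p)"
  for F :: "nat list \<Rightarrow> real"
proof -
  have coord: "{\<omega> \<in> space (mu p). \<omega> i = k} \<in> sets (mu p)" for i k
    using measurable_sets[OF measurable_coordinate, of "{k}" i]
    by (simp add: vimage_def Int_def conj_commute)
  have eq: "map \<omega> [0..<n] = w \<longleftrightarrow> length w = n \<and> (\<forall>i\<in>{..<n}. \<omega> i = w ! i)" for \<omega> :: "nat \<Rightarrow> nat" and w
    by (subst list_eq_iff_nth_eq) auto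
  have "(\<lambda>\<omega>. map \<omega> [0..<n]) -` {w} \<inter> space (mu p) \<in> sets (mu p)" for w
  proof -
    have "(\<lambda>\<omega>. map \<omega> [0..<n]) -` {w} \<inter> space (mu p)
      = {\<omega> \<in> space (mu p). length w = n \<and> (\<forall>i\<in>{..<n}. \<omega> i = w ! i)}"
      unfolding eq[symmetric] by blast
    also have "\<dots> \<in> sets (mu p)"
      by (rule sets.sets_Collect_conj[OF sets.sets_Collect_countable_Ball[OF coord] sets.sets_Collect_const])
    finally show ?thesis .
  qed
  then have "(\<lambda>\<omega>. map \<omega> [0..<n]) \<in> mu p \<rightarrow>\<^sub>M count_space UNIV"
    by (intro measurable_count_space_eq2_countable[THEN iffD2]) simp
  then show ?thesis by (rule measurable_compose) simp
qed

text \<open>Coordinate 0 is split off by \<open>PiM_iter\<close> and Fubini; the induction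
  hypothesis then applies to the function of the remaining prefix with that letter fixed.\<close>

lemma integral_prefix: "(\<integral>\<omega>. F (map \<omega> [0..<n]) \<partial>mu p) = avg n F"
proof (induction n arbitrary: F)
  case 0
  interpret prob_space letter_space by (rule prob_space_letter)
  interpret sequence_space letter_space ..
  interpret M: prob_space "mu p" unfolding mu_eq by (rule P.prob_space_axioms)
  show ?case by (simp add: M.prob_space)
next
  case (Suc n)
  interpret prob_space letter_space by (rule prob_space_letter)
  interpret sequence_space letter_space ..
  interpret M: prob_space "mu p" unfolding mu_eq by (rule P.prob_space_axioms)
  interpret pair: pair_prob_space letter_space "mu p" ..
  have meas: "(\<lambda>(s, \<omega>). case_nat s \<omega>) \<in> letter_space \<Otimes>\<^sub>M mu p \<rightarrow>\<^sub>M mu p"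
    unfolding mu_eq by measurable
  have F: "(\<lambda>\<omega>. F (map \<omega> [0..<Suc n])) \<in> borel_measurable (mu p)"
    by (rule measurable_prefix)
  have eq: "map (case_nat s \<omega>) [0..<Suc n] = s # map \<omega> [0..<n]" for s and \<omega> :: "nat \<Rightarrow> nat"
    by (simp add: map_upt_Suc del: upt_Suc)
  \<comment> \<open>As each factor is cut down to the support, only finitely many prefixes occur, so
    even an arbitrary \<open>F\<close> is bounded at every point of the space.\<close>
  have "finite ((\<lambda>w. \<bar>F w\<bar>) ` words (Suc n))" by simp
  then obtain B where B: "\<bar>F w\<bar> \<le> B" if "w \<in> words (Suc n)" for w
    using that Max_ge[of "(\<lambda>w. \<bar>F w\<bar>) ` words (Suc n)"] by (metis imageI)
  have m: "(\<lambda>(s, \<omega>). F (s # map \<omega> [0..<n])) \<in> borel_measurable (letter_space \<Otimes>\<^sub>M mu p)"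
    using measurable_compose[OF meas F] by (simp add: case_prod_unfold eq del: upt_Suc)
  have int: "integrable (letter_space \<Otimes>\<^sub>M mu p) (\<lambda>(s, \<omega>). F (s # map \<omega> [0..<n]))"
  proof (rule pair.integrable_const_bound[OF AE_I2 m])
    fix x assume "x \<in> space (letter_space \<Otimes>\<^sub>M mu p)"
    then have "fst x # map (snd x) [0..<n] \<in> words (Suc n)"
      by (auto simp: words_def space_pair_measure space_letter space_mu Omega_def)
    then show "norm (case x of (s, \<omega>) \<Rightarrow> F (s # map \<omega> [0..<n])) \<le> B"
      using B by (simp add: case_prod_unfold)
  qed
  have "(\<integral>\<omega>. F (map \<omega> [0..<Suc n]) \<partial>mu p)
    = (\<integral>\<omega>. F (map \<omega> [0..<Suc n]) \<partial>distr (letter_space \<Otimes>\<^sub>M mu p) (mu p) (\<lambda>(s, \<omega>). case_nat s \<omega>))"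
    using PiM_iter by (simp add: mu_eq)
  also have "\<dots> = (\<integral>(s, \<omega>). F (s # map \<omega> [0..<n]) \<partial>(letter_space \<Otimes>\<^sub>M mu p))"
    by (subst integral_distr[OF meas F]) (simp add: case_prod_unfold eq del: upt_Suc)
  also have "\<dots> = (\<integral>s. \<integral>\<omega>. F (s # map \<omega> [0..<n]) \<partial>mu p \<partial>letter_space)"
    using pair.integral_fst'[OF int] by simp
  also have "\<dots> = (\<integral>s. avg n (\<lambda>w. F (s # w)) \<partial>letter_space)"
    by (intro Bochner_Integration.integral_cong refl) (rule Suc.IH)
  also have "\<dots> = (\<integral>s. indicator (set_pmf p) s * avg n (\<lambda>w. F (s # w)) \<partial>measure_pmf p)"
    unfolding letter_space_def by (subst integral_restrict_space) auto
  also have "\<dots> = (\<Sum>s\<in>set_pmf p. avg n (\<lambda>w. F (s # w)) * pmf p s)"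
    by (subst integral_measure_pmf_real[of "set_pmf p"]) auto
  also have "\<dots> = avg (Suc n) F" by (simp add: avg_Suc mult.commute)
  finally show ?case .
qed

text \<open>The cocycle reads the indices 1 to \<open>n\<close>, whereas prefixes start at 0: hence
  a prefix of length n + 1 without its head. In \<open>lyap_avg_eq\<close> the unread letter
  averages out.\<close>

lemma cocycle_iter_eq: "cocycle_iter n E \<omega> = word_mat E (tl (map \<omega> [0..<Suc n]))"
proof (induction n)
  case (Suc n)
  have "tl (map \<omega> [0..<Suc (Suc n)]) = tl (map \<omega> [0..<Suc n]) @ [\<omega> (Suc n)]"
    by (subst upt_Suc_append) (simp_all add: tl_append2 del: upt_Suc)
  then show ?case using Suc by (simp add: cocycle_def shift_pow word_mat_append del: upt_Suc)
qed simp

lemma lyap_avg_eq: "lyap_avg p E n = mean_log n E / n"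
proof -
  have p1: "(\<Sum>a\<in>set_pmf p. pmf p a) = 1" by (rule sum_pmf_eq_1) auto
  have "(\<integral>\<omega>. ln (opnorm (cocycle_iter n E \<omega>)) \<partial>mu p) = avg (Suc n) (\<lambda>w. ln (opnorm (word_mat E (tl w))))"
    unfolding cocycle_iter_eq by (rule integral_prefix)
  also have "\<dots> = mean_log n E"
    by (simp add: avg_Suc mean_log_def sum_distrib_right[symmetric] p1)
  finally show ?thesis by (simp add: lyap_avg_def)
qed

lemma lyap_avg_tendsto: "lyap_avg p E \<longlonglongrightarrow> lyap E"
  using lyap_tendsto[of E] by (simp add: lyap_avg_eq[abs_def])

lemma lyapunov_eq: "lyapunov p E = lyap E"
  unfolding lyapunov_def by (rule limI[OF lyap_avg_tendsto])

end

theorem theorem3p2: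
  fixes d :: nat and p :: "nat pmf"
  assumes "d > 2"
    and "set_pmf p \<subseteq> {2..d}"
    and "card (set_pmf p) \<ge> 2"
  shows "(\<forall>E. E \<noteq> 0 \<longrightarrow>
            subgroup (G_nu p E) SL2 \<and> \<not> compact (G_nu p E) \<and>
            strongly_irreducible (G_nu p E) \<and> contracting (G_nu p E)) \<and>
         (\<forall>E. {V \<in> RP1. \<forall>M \<in> G_nu p E. act M V = V} = {}) \<and>
         ((\<forall>E. convergent (lyap_avg p E)) \<and> continuous_on UNIV (lyapunov p)) \<and>
         ((\<forall>E. E \<noteq> 0 \<longrightarrow> lyapunov p E > 0) \<and> lyapunov p 0 = 0)"
proof -
  interpret letters p d using assms(2,3) by unfold_locales
  have "lyapunov p = lyap" by (rule ext) (rule lyapunov_eq)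
  moreover have "continuous_on UNIV lyap" by (simp add: continuous_on_eq_continuous_at isCont_lyap)
  moreover have "convergent (lyap_avg p E)" for E using lyap_avg_tendsto by (rule convergentI)
  ultimately show ?thesis
    using subgroup_G not_compact_G strongly_irreducible_G contracting_G no_invariant_line lyap_pos lyap_0
    by simp
qed

end
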